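(* Let $(\mathbb{X}_{\mathcal{B}},\mathbb{Z}^d)$ be a $\mathcal{B}$-free lattice system, with symmetry group $\mathcal{S}=\mathcal{S}(\mathbb{X}_{\mathcal{B}})$. Then the group of extended symmetries is given by $\mathcal{R}=\mathcal{R}(\mathbb{X}_{\mathcal{B}})=\mathcal{S}\rtimes\mathrm{GL}(d,\mathbb{Z})$, which is to say that the extension is always the maximally possible one. If $(\mathbb{X}_{\mathcal{B}},\mathbb{Z}^d)$ is Erdős, one has $\mathbb{X}_{\mathcal{B}}=\mathbb{A}$, the system is hereditary, and it has minimal symmetry group, $\mathcal{S}=\mathcal{G}\simeq\mathbb{Z}^d$, and thus $\mathcal{R}=\mathbb{Z}^d\rtimes\mathrm{GL}(d,\mathbb{Z})$.
   Context: Let $d\geqslant 1$. Subsets $U\subseteq\mathbb{Z}^d$ are identified with configurations $1_U\in\{0,1\}^{\mathbb{Z}^d}$, with the product topology. Let $\mathcal{B}=\{b_i : i\in\mathbb{N}\}$ be an infinite set of positive integers that is primitive, i.e. $b_i\mid b_j$ implies $i=j$. Put $V_{\mathcal{B}}=\mathbb{Z}^d\setminus\bigcup_{i\in\mathbb{N}}b_i\mathbb{Z}^d$, and let $\mathbb{X}_{\mathcal{B}}=\overline{\mathbb{Z}^d+V_{\mathcal{B}}}$ be the closure of $\{t+V_{\mathcal{B}} : t\in\mathbb{Z}^d\}$. The system $(\mathbb{X}_{\mathcal{B}},\mathbb{Z}^d)$, with the shift action $T_t(U)=U-t$ (i.e. $(T_tx)_n=x_{n+t}$), is called a $\mathcal{B}$-free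 lattice system. It is Erdős when the $b_i$ are pairwise coprime and $\sum_{b\in\mathcal{B}}b^{-d}<\infty$. A set $U\subset\mathbb{Z}^d$ is admissible for $\mathcal{B}$ if, for every $b\in\mathcal{B}$, $U$ misses at least one coset of $b\,\mathbb{Z}^d$; $\mathbb{A}$ is the set of all admissible subsets of $\mathbb{Z}^d$. A subshift is hereditary if it is closed under the formation of subsets. $\mathrm{Aut}(\mathbb{X})$ is the group of all homeomorphisms of a subshift $\mathbb{X}$, $\mathcal{G}=\{T_t|_{\mathbb{X}} : t\in\mathbb{Z}^d\}$, $\mathcal{S}(\mathbb{X})$ is the centraliser of $\mathcal{G}$ in $\mathrm{Aut}(\mathbb{X})$, and $\mathcal{R}(\mathbb{X})=\{H\in\mathrm{Aut}(\mathbb{X}) : H\mathcal{G}H^{-1}=\mathcal{G}\}$ is its normaliser. The conjugation action on $\mathcal{G}\simeq\mathbb{Z}^d$ gives a homomorphism $\psi:\mathcal{R}(\mathbb{X})\to\mathrm{GL}(d,\mathbb{Z})$ with kernel $\mathcal{S}(\mathbb{X})$, where $HT_nH^{-1}=T_{\psi(H)n}$; the extension is maximal when $\psi$ is onto. In $\mathcal{S}\rtimes\mathrm{GL}(d,\mathbb{Z})$, a matrix $M\in\mathrm{GL}(d,\mathbb{Z})$ is identified with the homeomorphism $h_M:U\mapsto MU$ (i.e. $(h_Mx)_n=x_{M^{-1}n}$), and the product is the internal semi-direct product with normal factor $\mathcal{S}$. *)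

theory Defs
  imports "HOL-Analysis.Analysis" "HOL-Algebra.Bij" "HOL-Algebra.Group_Action"
begin

section \<open>Subsets of the integer lattice as configurations\<close>

text \<open>
  The lattice of dimension \<open>d = CARD('n) \<ge> 1\<close> is the type \<^typ>\<open>int^'n\<close>. A configuration is a
  subset of it; the topology is the one that the identification of \<open>U\<close> with its indicator
  function pulls back from the product topology on the 0-1 configurations.
\<close>

definition config_topology :: "(int^'n) set topology" where
  "config_topology =
     pullback_topology UNIV (\<lambda>U. (indicator U :: int^'n \<Rightarrow> nat))
       (product_topology (\<lambda>_. discrete_topology {0, 1}) UNIV)"

definition shift :: "int^'n \<Rightarrow> (int^'n) set \<Rightarrow> (int^'n) set" where
  "shift t U = (\<lambda>x. x - t) ` U"

definition matrix_map :: "int^'n^'n \<Rightarrow> (int^'n) set \<Rightarrow> (int^'n) set" where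
  "matrix_map M U = (\<lambda>x. M *v x) ` U"

definition subshift :: "(int^'n) set set \<Rightarrow> bool" where
  "subshift X \<longleftrightarrow> closedin config_topology X \<and> (\<forall>t. shift t ` X = X)"

definition hereditary :: "(int^'n) set set \<Rightarrow> bool" where
  "hereditary X \<longleftrightarrow> subshift X \<and> (\<forall>U\<in>X. \<forall>W. W \<subseteq> U \<longrightarrow> W \<in> X)"


section \<open>\<open>\<B>\<close>-free lattice systems\<close>

definition primitive :: "nat set \<Rightarrow> bool" where
  "primitive B \<longleftrightarrow> (\<forall>a\<in>B. \<forall>b\<in>B. a dvd b \<longrightarrow> a = b)"

definition multiples :: "nat \<Rightarrow> (int^'n) set" where
  "multiples b = range (\<lambda>v. int b *s v)"

definition bfree_points :: "nat set \<Rightarrow> (int^'n) set" where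
  "bfree_points B = UNIV - (\<Union>b\<in>B. multiples b)"

definition bfree_system :: "nat set \<Rightarrow> (int^'n) set set" where
  "bfree_system B =
     Abstract_Topology.closure_of config_topology (range (\<lambda>t. (\<lambda>x. t + x) ` bfree_points B))"

definition erdos :: "nat \<Rightarrow> nat set \<Rightarrow> bool" where
  "erdos d B \<longleftrightarrow> pairwise coprime B \<and> (\<lambda>b. 1 / real b ^ d) summable_on B"

definition admissible :: "nat set \<Rightarrow> (int^'n) set \<Rightarrow> bool" where
  "admissible B U \<longleftrightarrow> (\<forall>b\<in>B. \<exists>c. U \<inter> (\<lambda>x. c + x) ` multiples b = {})"


section \<open>Symmetries and extended symmetries\<close>

text \<open>
  Self-maps of \<open>X\<close> are represented as in \<^const>\<open>BijGroup\<close>, by functions that are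
  \<^const>\<open>undefined\<close> outside \<open>X\<close>; hence the restrictions below.
\<close>

definition Aut :: "(int^'n) set set \<Rightarrow> ((int^'n) set \<Rightarrow> (int^'n) set) monoid" where
  "Aut X = BijGroup X
     \<lparr>carrier := {H \<in> Bij X. homeomorphic_map (subtopology config_topology X)
                                             (subtopology config_topology X) H}\<rparr>"

definition shift_on :: "(int^'n) set set \<Rightarrow> int^'n \<Rightarrow> (int^'n) set \<Rightarrow> (int^'n) set" where
  "shift_on X t = restrict (shift t) X"

definition matrix_on :: "(int^'n) set set \<Rightarrow> int^'n^'n \<Rightarrow> (int^'n) set \<Rightarrow> (int^'n) set" where
  "matrix_on X M = restrict (matrix_map M) X"

definition shifts :: "(int^'n) set set \<Rightarrow> ((int^'n) set \<Rightarrow> (int^'n) set) set" where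
  "shifts X = range (shift_on X)"

definition centraliser :: "('a, 'b) monoid_scheme \<Rightarrow> 'a set \<Rightarrow> 'a set" where
  "centraliser G A = {h \<in> carrier G. \<forall>g\<in>A. h \<otimes>\<^bsub>G\<^esub> g = g \<otimes>\<^bsub>G\<^esub> h}"

definition symmetries :: "(int^'n) set set \<Rightarrow> ((int^'n) set \<Rightarrow> (int^'n) set) set" where
  "symmetries X = centraliser (Aut X) (shifts X)"

definition ext_symmetries :: "(int^'n) set set \<Rightarrow> ((int^'n) set \<Rightarrow> (int^'n) set) monoid" where
  "ext_symmetries X = (Aut X)\<lparr>carrier := normalizer (Aut X) (shifts X)\<rparr>"


section \<open>The group \<open>GL(d, \<int>)\<close>, the homomorphism \<open>\<psi>\<close> and semi-direct products\<close>

definition GLZ :: "(int^'n^'n) monoid" where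
  "GLZ = \<lparr>carrier = {M. invertible M}, monoid.mult = (**), one = mat 1\<rparr>"

definition lattice_group :: "(int^'n) monoid" where
  "lattice_group = \<lparr>carrier = UNIV, monoid.mult = (+), one = 0\<rparr>"

definition psi :: "(int^'n) set set \<Rightarrow> ((int^'n) set \<Rightarrow> (int^'n) set) \<Rightarrow> int^'n^'n" where
  "psi X H = (THE M. invertible M \<and>
     (\<forall>n. H \<otimes>\<^bsub>Aut X\<^esub> shift_on X n \<otimes>\<^bsub>Aut X\<^esub> inv\<^bsub>Aut X\<^esub> H = shift_on X (M *v n)))"

definition internal_semidirect :: "('a, 'b) monoid_scheme \<Rightarrow> 'a set \<Rightarrow> 'a set \<Rightarrow> bool" where
  "internal_semidirect G N K \<longleftrightarrow>
     N \<lhd> G \<and> subgroup K G \<and> N \<inter> K = {\<one>\<^bsub>G\<^esub>} \<and> N <#>\<^bsub>G\<^esub> K = carrier G"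

text \<open>The external product of \<open>\<int>\<^sup>d\<close> and \<open>GL(d, \<int>)\<close> for the standard action.\<close>

definition lattice_semidirect_GLZ :: "((int^'n) \<times> (int^'n^'n)) monoid" where
  "lattice_semidirect_GLZ =
     \<lparr>carrier = UNIV \<times> {M. invertible M},
      monoid.mult = (\<lambda>(m, M) (n, N). (m + M *v n, M ** N)),
      one = (0, mat 1)\<rparr>"

end

theory Submission
  imports Defs
begin

text \<open>
  A homeomorphism \<open>H\<close> of \<open>X\<close> that normalises the group of shifts conjugates \<open>T\<^sub>n\<close> to some
  \<open>T\<^sub>m\<close>. When the shifts act faithfully, \<open>m\<close> is an additive function of \<open>n\<close> with additive
  inverse, hence given by a matrix in \<open>GL(d, \<int>)\<close>; this is \<open>\<psi>\<close>, and its kernel is the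
  centraliser of the shifts. Every \<open>M \<in> GL(d, \<int>)\<close> preserves each lattice \<open>b\<int>\<^sup>d\<close>, so it fixes the
  set of \<open>\<B>\<close>-free points and maps the orbit closure \<open>X\<close> to itself. Thus \<open>M \<mapsto> h\<^sub>M\<close> splits \<open>\<psi>\<close>,
  and a split epimorphism is an internal semi-direct product. The locale
  \<open>symmetric_subshift\<close> contains this argument for any \<open>X\<close> that is invariant under shifts and
  matrices and on which no nonzero shift is trivial. For \<open>\<B>\<close>-free systems the last property follows
  from \<open>bfree_points_aperiodic\<close>.

  In the Erdos case, every point of \<open>X\<close> is admissible by pigeonhole on residues
  (\<open>bfree_system_imp_admissible\<close>). For the converse, a finite pattern of an admissible set has to be
  found in the \<open>\<B>\<close>-free points. Chinese remaindering over finitely many \<open>b\<close> kills the points to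
  be removed and makes the small \<open>b\<close> harmless for the points to be kept. The solutions form a
  residue class, and a positive proportion of it avoids all other \<open>b\<close>, because the series of
  \<open>b\<^bsup>-d\<^esup>\<close> converges (\<open>exists_good_translate\<close>).

  The centraliser is trivial for the following reason. By compactness, a homeomorphism \<open>H\<close> that
  commutes with the shifts is a local code, so \<open>H(U \<union> W) = H(U) \<union> (W + P)\<close> with \<open>P = H({0})\<close> for
  every finite set \<open>W\<close> that is sparse and far from the finite set \<open>U\<close>. If \<open>U\<close> misses the class
  of \<open>c\<close> modulo \<open>b\<close>, then \<open>W\<close> can be chosen to occupy all classes modulo \<open>b\<close> but this one, with
  \<open>U \<union> W\<close> still admissible. For \<open>p \<in> P\<close>, the set \<open>W + p\<close> leaves the class of \<open>c + p\<close> as the only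
  one that the admissible set \<open>H(U \<union> W)\<close> can miss, so \<open>H(U)\<close> misses it too (\<open>missed_residue\<close>).
  As \<open>b\<close> is arbitrarily large, \<open>H(U) \<subseteq> U + p\<close>. The same holds for the inverse of \<open>H\<close>, so that
  \<open>H(U) = U + p\<close> for finite \<open>U\<close>, and then for all \<open>U\<close> because \<open>H\<close> is a local code.
\<close>

section \<open>The topology of configurations\<close>

lemma topspace_config [simp]: "topspace (config_topology :: (int^'n) set topology) = UNIV"
  by (auto simp: config_topology_def topspace_pullback_topology indicator_def)

text \<open>
  Through this description of the open sets, closures, continuity and compactness become statements
  about finite windows.
\<close>

lemma openin_config_iff:
  fixes S :: "(int^'n) set set"
  shows "openin config_topology S \<longleftrightarrow>
    (\<forall>U\<in>S. \<exists>F. finite F \<and> (\<forall>U'. U' \<inter> F = U \<inter> F \<longrightarrow> U' \<in> S))"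
proof
  assume "openin config_topology S"
  then obtain V where V: "openin (product_topology (\<lambda>_::int^'n. discrete_topology {0, 1::nat}) UNIV) V"
    and S: "S = indicator -` V"
    unfolding config_topology_def openin_pullback_topology by auto
  show "\<forall>U\<in>S. \<exists>F. finite F \<and> (\<forall>U'. U' \<inter> F = U \<inter> F \<longrightarrow> U' \<in> S)"
  proof
    fix U assume "U \<in> S"
    then have "indicator U \<in> V" using S by auto
    from bspec[OF V[unfolded openin_product_topology_alt] this]
    obtain W where "finite {i \<in> UNIV. W i \<noteq> topspace (discrete_topology {0,1::nat})}"
      and W: "indicator U \<in> PiE UNIV W" "PiE UNIV W \<subseteq> V"
      by (elim exE conjE) (rule that)
    then have fin: "finite {i. W i \<noteq> {0,1::nat}}" by simp
    have "U' \<in> S" if eq: "U' \<inter> {i. W i \<noteq> {0,1}} = U \<inter> {i. W i \<noteq> {0,1}}" for U'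
    proof -
      have "(indicator U' :: int^'n \<Rightarrow> nat) i \<in> W i" for i
      proof (cases "W i = {0,1}")
        case False
        then have "(indicator U' :: int^'n \<Rightarrow> nat) i = indicator U i"
          using arg_cong[OF eq, of "\<lambda>S. i \<in> S"] by (simp add: indicator_def)
        then show ?thesis using W(1) by (metis PiE_mem UNIV_I)
      qed (auto simp: indicator_def)
      then show ?thesis using W(2) S by (auto simp: PiE_iff)
    qed
    with fin show "\<exists>F. finite F \<and> (\<forall>U'. U' \<inter> F = U \<inter> F \<longrightarrow> U' \<in> S)" by blast
  qed
next
  assume S: "\<forall>U\<in>S. \<exists>F. finite F \<and> (\<forall>U'. U' \<inter> F = U \<inter> F \<longrightarrow> U' \<in> S)"
  define V where "V = {f :: int^'n \<Rightarrow> nat. range f \<subseteq> {0,1} \<and> {x. f x = 1} \<in> S}"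
  have "openin (product_topology (\<lambda>_::int^'n. discrete_topology {0, 1::nat}) UNIV) V"
    unfolding openin_product_topology_alt
  proof (intro ballI)
    fix f assume f: "f \<in> V"
    then have "{x. f x = 1} \<in> S" by (simp add: V_def)
    from bspec[OF S this] obtain F
      where F: "finite F" "\<And>U'. U' \<inter> F = {x. f x = 1} \<inter> F \<Longrightarrow> U' \<in> S"
      by metis
    define W where "W i = (if i \<in> F then {f i} else {0,1})" for i
    have "PiE UNIV W \<subseteq> V"
    proof
      fix g assume g: "g \<in> PiE UNIV W"
      have gi: "g i \<in> W i" for i using g by auto
      have "range g \<subseteq> {0,1}"
        using gi f unfolding W_def V_def by (force split: if_splits)
      moreover have "{x. g x = 1} \<inter> F = {x. f x = 1} \<inter> F"
        using gi unfolding W_def by (fastforce split: if_splits)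
      ultimately show "g \<in> V" using F(2) unfolding V_def by blast
    qed
    moreover have "finite {i. W i \<noteq> {0,1}}"
      by (rule finite_subset[OF _ F(1)]) (auto simp: W_def)
    moreover have "f \<in> PiE UNIV W" "\<forall>i. W i \<subseteq> {0,1}"
      using f by (auto simp: W_def V_def)
    ultimately show "\<exists>U. finite {i \<in> UNIV. U i \<noteq> topspace (discrete_topology {0, 1})} \<and>
             (\<forall>i\<in>UNIV. openin (discrete_topology {0, 1}) (U i)) \<and> f \<in> Pi\<^sub>E UNIV U \<and> Pi\<^sub>E UNIV U \<subseteq> V"
      by (intro exI[of _ W]) auto
  qed
  moreover have "S = indicator -` V"
    by (auto simp: V_def indicator_def)
  ultimately show "openin config_topology S"
    unfolding config_topology_def openin_pullback_topology by auto
qed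

lemma openin_configD:
  "openin config_topology S \<Longrightarrow> U \<in> S \<Longrightarrow> \<exists>F. finite F \<and> (\<forall>U'. U' \<inter> F = U \<inter> F \<longrightarrow> U' \<in> S)"
  unfolding openin_config_iff by (rule bspec)

lemma openin_cylinder:
  "finite F \<Longrightarrow> openin config_topology {W. W \<inter> F = U \<inter> F}"
  unfolding openin_config_iff by auto

lemma in_config_closure_iff:
  fixes S :: "(int^'n) set set"
  shows "U \<in> config_topology closure_of S \<longleftrightarrow> (\<forall>F. finite F \<longrightarrow> (\<exists>W\<in>S. W \<inter> F = U \<inter> F))"
proof
  assume U: "U \<in> config_topology closure_of S"
  show "\<forall>F. finite F \<longrightarrow> (\<exists>W\<in>S. W \<inter> F = U \<inter> F)"
  proof (intro allI impI)
    fix F :: "(int^'n) set" assume "finite F"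
    then have "openin config_topology {W. W \<inter> F = U \<inter> F}"
      unfolding openin_config_iff by auto
    then show "\<exists>W\<in>S. W \<inter> F = U \<inter> F"
      using U[unfolded in_closure_of, THEN conjunct2, THEN spec, of "{W. W \<inter> F = U \<inter> F}"]
      by (simp add: Bex_def)
  qed
next
  assume R: "\<forall>F. finite F \<longrightarrow> (\<exists>W\<in>S. W \<inter> F = U \<inter> F)"
  have "\<exists>y. y \<in> S \<and> y \<in> T" if T: "U \<in> T" "openin config_topology T" for T
  proof -
    obtain F where "finite F" "\<And>U'. U' \<inter> F = U \<inter> F \<Longrightarrow> U' \<in> T"
      using T(2)[unfolded openin_config_iff, rule_format, OF T(1)] by blast
    moreover from this(1) obtain W where "W \<in> S" "W \<inter> F = U \<inter> F" using R by metis
    ultimately show ?thesis by blast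
  qed
  then show "U \<in> config_topology closure_of S"
    unfolding in_closure_of by auto
qed

lemma compact_space_config: "compact_space (config_topology :: (int^'n) set topology)"
proof -
  let ?P = "product_topology (\<lambda>_::int^'n. discrete_topology {0, 1::nat}) UNIV"
  let ?g = "\<lambda>f. {x::int^'n. f x = (1::nat)}"
  have "compactin ?P (topspace ?P)"
    unfolding compact_space_def[symmetric] compact_space_product_topology
    by (simp add: compact_space_discrete_topology)
  moreover have "continuous_map ?P config_topology ?g"
    unfolding config_topology_def
  proof (rule continuous_map_pullback')
    show "continuous_map ?P ?P (indicator \<circ> ?g)"
      by (rule continuous_map_eq[OF continuous_map_id])
        (auto simp: fun_eq_iff indicator_def)
  qed auto
  ultimately have "compactin config_topology (?g ` topspace ?P)"
    by (rule image_compactin)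
  moreover have "?g ` topspace ?P = UNIV"
  proof -
    have "U \<in> ?g ` topspace ?P" for U
      by (rule image_eqI[where x = "indicator U"]) (auto simp: indicator_def)
    then show ?thesis by blast
  qed
  ultimately show ?thesis by (simp add: compact_space_def)
qed

lemma continuous_map_config_iff:
  fixes X Y :: "(int^'n) set set"
  shows "continuous_map (subtopology config_topology X) (subtopology config_topology Y) H \<longleftrightarrow>
    H ` X \<subseteq> Y \<and> (\<forall>x. \<forall>U\<in>X. \<exists>F. finite F \<and>
       (\<forall>U'\<in>X. U' \<inter> F = U \<inter> F \<longrightarrow> (x \<in> H U' \<longleftrightarrow> x \<in> H U)))" (is "?L \<longleftrightarrow> _ \<and> ?R")
proof -
  have "continuous_map (subtopology config_topology X) config_topology H \<longleftrightarrow> ?R"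
  proof
    assume H: "continuous_map (subtopology config_topology X) config_topology H"
    show ?R
    proof (intro allI ballI)
      fix x U assume U: "U \<in> X"
      have "openin config_topology {W. x \<in> W \<longleftrightarrow> x \<in> H U}"
        unfolding openin_config_iff by (auto intro!: exI[of _ "{x}"])
      then have "openin (subtopology config_topology X) {U' \<in> X. x \<in> H U' \<longleftrightarrow> x \<in> H U}"
        using openin_continuous_map_preimage[OF H] by fastforce
      then obtain T where T: "openin config_topology T"
          "{U' \<in> X. x \<in> H U' \<longleftrightarrow> x \<in> H U} = T \<inter> X"
        by (auto simp: openin_subtopology)
      have "U \<in> T \<inter> X" unfolding T(2)[symmetric] using U by blast
      then have "U \<in> T" by blast
      then obtain F where F: "finite F" "\<And>U'. U' \<inter> F = U \<inter> F \<Longrightarrow> U' \<in> T"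
        using openin_configD[OF T(1)] by blast
      have "x \<in> H U' \<longleftrightarrow> x \<in> H U" if "U' \<in> X" "U' \<inter> F = U \<inter> F" for U'
      proof -
        have "U' \<in> T \<inter> X" using F(2)[OF that(2)] that(1) by blast
        then show ?thesis unfolding T(2)[symmetric] by blast
      qed
      with F(1) show "\<exists>F. finite F \<and> (\<forall>U'\<in>X. U' \<inter> F = U \<inter> F \<longrightarrow> (x \<in> H U' \<longleftrightarrow> x \<in> H U))"
        by auto
    qed
  next
    assume R: ?R
    show "continuous_map (subtopology config_topology X) config_topology H"
      unfolding continuous_map
    proof (intro conjI allI impI)
      fix T :: "(int^'n) set set" assume T: "openin config_topology T"
      have "\<exists>F. finite F \<and> (\<forall>U'\<in>X. U' \<inter> F = U \<inter> F \<longrightarrow> H U' \<in> T)"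
        if U: "U \<in> X" "H U \<in> T" for U
      proof -
        obtain E where E: "finite E" "\<And>W. W \<inter> E = H U \<inter> E \<Longrightarrow> W \<in> T"
          using openin_configD[OF T U(2)] by blast
        have "\<forall>x. \<exists>F. finite F \<and> (\<forall>U'\<in>X. U' \<inter> F = U \<inter> F \<longrightarrow> (x \<in> H U' \<longleftrightarrow> x \<in> H U))"
          using R U by blast
        then obtain F where F: "\<And>x. finite (F x)"
          "\<And>x U'. U' \<in> X \<Longrightarrow> U' \<inter> F x = U \<inter> F x \<Longrightarrow> (x \<in> H U' \<longleftrightarrow> x \<in> H U)"
          by metis
        show ?thesis
        proof (intro exI conjI ballI impI)
          show "finite (\<Union>x\<in>E. F x)" using E F by blast
          fix U' assume U': "U' \<in> X" "U' \<inter> (\<Union>x\<in>E. F x) = U \<inter> (\<Union>x\<in>E. F x)"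
          have "x \<in> H U' \<longleftrightarrow> x \<in> H U" if "x \<in> E" for x
            using U' that by (intro F(2)) auto
          then show "H U' \<in> T" by (intro E(2)) auto
        qed
      qed
      then obtain G where G: "\<And>U. U \<in> X \<Longrightarrow> H U \<in> T \<Longrightarrow> finite (G U)"
        "\<And>U U'. U \<in> X \<Longrightarrow> H U \<in> T \<Longrightarrow> U' \<in> X \<Longrightarrow> U' \<inter> G U = U \<inter> G U \<Longrightarrow> H U' \<in> T"
        by metis
      define T' where "T' = (\<Union>U\<in>{U\<in>X. H U \<in> T}. {W. W \<inter> G U = U \<inter> G U})"
      have "openin config_topology T'"
        unfolding T'_def by (intro openin_Union) (auto intro!: openin_cylinder G)
      moreover have "{x \<in> topspace (subtopology config_topology X). H x \<in> T} = T' \<inter> X"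
        using G(2) by (auto simp: T'_def)
      ultimately show "openin (subtopology config_topology X)
          {x \<in> topspace (subtopology config_topology X). H x \<in> T}"
        unfolding openin_subtopology by blast
    qed auto
  qed
  then show ?thesis
    by (simp only: continuous_map_in_subtopology topspace_subtopology topspace_config
        Int_UNIV_left image_subset_iff_funcset conj_commute)
qed

text \<open>
  The Curtis-Hedlund-Lyndon theorem, for one coordinate: by compactness, the window on which
  \<open>x \<in> H U\<close> depends can be chosen uniformly in \<open>U\<close>.
\<close>

lemma uniform_window:
  fixes X :: "(int^'n) set set"
  assumes "closedin config_topology X"
    and "continuous_map (subtopology config_topology X) (subtopology config_topology X) H"
  obtains F where "finite F"
    "\<And>U U'. U \<in> X \<Longrightarrow> U' \<in> X \<Longrightarrow> U' \<inter> F = U \<inter> F \<Longrightarrow> (x \<in> H U' \<longleftrightarrow> x \<in> H U)"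
proof -
  have "\<forall>U\<in>X. \<exists>F. finite F \<and> (\<forall>U'\<in>X. U' \<inter> F = U \<inter> F \<longrightarrow> (x \<in> H U' \<longleftrightarrow> x \<in> H U))"
    using assms(2) unfolding continuous_map_config_iff by blast
  then obtain F where F: "\<And>U. U \<in> X \<Longrightarrow> finite (F U)"
     "\<And>U U'. U \<in> X \<Longrightarrow> U' \<in> X \<Longrightarrow> U' \<inter> F U = U \<inter> F U \<Longrightarrow> (x \<in> H U' \<longleftrightarrow> x \<in> H U)"
    by metis
  define C where "C U = {U'. U' \<inter> F U = U \<inter> F U}" for U
  have "compactin config_topology X"
    using assms(1) compact_space_config closedin_compact_space by blast
  moreover have "\<forall>V\<in>C ` X. openin config_topology V" "X \<subseteq> \<Union>(C ` X)"
    using F(1) by (auto simp: C_def openin_config_iff)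
  ultimately obtain \<V> where "finite \<V>" "\<V> \<subseteq> C ` X" "X \<subseteq> \<Union>\<V>"
    unfolding compactin_def by metis
  then obtain I where I: "finite I" "I \<subseteq> X" "X \<subseteq> (\<Union>U\<in>I. C U)"
    by (metis finite_subset_image)
  show ?thesis
  proof (rule that)
    show "finite (\<Union>U\<in>I. F U)" using I F by blast
    fix U U' assume U: "U \<in> X" "U' \<in> X" "U' \<inter> (\<Union>U\<in>I. F U) = U \<inter> (\<Union>U\<in>I. F U)"
    then obtain W where W: "W \<in> I" "U \<inter> F W = W \<inter> F W" using I unfolding C_def by blast
    then have "U' \<inter> F W = W \<inter> F W" using U by blast
    moreover have "W \<in> X" using W(1) I(2) by blast
    ultimately have "x \<in> H U' \<longleftrightarrow> x \<in> H W"
      by (intro F(2)[OF _ U(2)])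
    moreover have "x \<in> H U \<longleftrightarrow> x \<in> H W"
      by (rule F(2)[OF \<open>W \<in> X\<close> U(1) W(2)])
    ultimately show "x \<in> H U' \<longleftrightarrow> x \<in> H U" by blast
  qed
qed

section \<open>Groups of extended symmetries\<close>

lemma mem_shift [simp]: "x \<in> shift t U \<longleftrightarrow> x + t \<in> U"
proof
  assume "x + t \<in> U"
  then show "x \<in> shift t U" unfolding shift_def by (rule rev_image_eqI) simp
qed (auto simp: shift_def)

lemma shift_shift: "shift s (shift t U) = shift (s + t) U"
  by (auto simp: add.assoc)

lemma shift_zero [simp]: "shift 0 U = U"
  by auto

lemma matrix_map_mult: "matrix_map M (matrix_map N U) = matrix_map (M ** N) U"
  by (simp add: matrix_map_def image_image matrix_vector_mul_assoc)

lemma matrix_map_one [simp]: "matrix_map (mat 1) U = U"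
  by (simp add: matrix_map_def)

lemma mem_matrix_map:
  assumes "M ** N = mat 1" "N ** M = mat 1"
  shows "x \<in> matrix_map M U \<longleftrightarrow> N *v x \<in> U"
proof
  assume "N *v x \<in> U"
  moreover have "x = M *v (N *v x)" by (simp add: matrix_vector_mul_assoc assms)
  ultimately show "x \<in> matrix_map M U" unfolding matrix_map_def by (rule rev_image_eqI)
qed (auto simp: matrix_map_def matrix_vector_mul_assoc assms)

lemma matrix_map_shift: "matrix_map M (shift t U) = shift (M *v t) (matrix_map M U)"
  by (simp add: matrix_map_def shift_def image_image matrix_vector_mult_diff_distrib)

text \<open>
  Over the integers, additivity already implies compatibility with scalars, so the images of the
  unit vectors determine the map.
\<close>

lemma additive_imp_matrix:
  fixes f :: "int^'n \<Rightarrow> int^'m"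
  assumes add: "\<And>u v. f (u + v) = f u + f v"
  shows "\<exists>M. \<forall>v. f v = M *v v"
proof -
  have zero: "f 0 = 0" using add[of 0 0] by simp
  have minus: "f (- v) = - f v" for v
    using add[of v "- v"] zero by (simp add: eq_neg_iff_add_eq_0 add.commute)
  have nat: "f (int k *s v) = int k *s f v" for k v
    by (induction k) (simp_all add: zero add vector_sadd_rdistrib)
  have smult: "f (c *s v) = c *s f v" for c v
  proof (cases c rule: int_cases2)
    case (nonneg n) then show ?thesis using nat by simp
  next
    case (nonpos n)
    have "f (c *s v) = f (- (int n *s v))"
      by (intro arg_cong[of _ _ f]) (simp add: nonpos vec_eq_iff)
    also have "\<dots> = - (int n *s f v)" by (simp only: minus nat)
    also have "\<dots> = c *s f v" by (simp add: nonpos vec_eq_iff)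
    finally show ?thesis .
  qed
  have sum: "f (sum g A) = (\<Sum>a\<in>A. f (g a))" if "finite A" for g and A :: "'n set"
    using that by (induction A) (simp_all add: zero add)
  have "f v = (\<chi> i j. f (axis j 1) $ i) *v v" for v
  proof -
    have "v = (\<Sum>j\<in>UNIV. v $ j *s axis j 1)" by (rule basis_expansion[symmetric])
    then have "f v = f (\<Sum>j\<in>UNIV. v $ j *s axis j 1)" by simp
    also have "\<dots> = (\<Sum>j\<in>UNIV. v $ j *s f (axis j 1))" by (simp add: sum smult)
    also have "\<dots> = (\<chi> i j. f (axis j 1) $ i) *v v"
      by (simp add: vec_eq_iff matrix_vector_mult_def mult.commute)
    finally show ?thesis .
  qed
  then show ?thesis by blast
qed

lemma (in group) mem_normalizer_iff:
  assumes "S \<subseteq> carrier G"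
  shows "g \<in> normalizer G S \<longleftrightarrow> g \<in> carrier G \<and> (\<lambda>s. g \<otimes> s \<otimes> inv g) ` S = S"
proof -
  have "g <# S #> inv g = (\<lambda>s. g \<otimes> s \<otimes> inv g) ` S"
    by (auto simp: l_coset_def r_coset_def)
  then show ?thesis using assms by (auto simp: normalizer_def stabilizer_def)
qed

text \<open>
  Each \<open>g\<close> is the product of \<open>g (s (p g))\<^sup>-\<^sup>1\<close>, which lies in the kernel, and \<open>s (p g)\<close>.
\<close>

lemma internal_semidirect_of_splitting:
  assumes G: "group G" and Q: "group Q" and p: "p \<in> hom G Q" and s: "s \<in> hom Q G"
    and ps: "\<And>q. q \<in> carrier Q \<Longrightarrow> p (s q) = q"
  shows "internal_semidirect G (kernel G Q p) (s ` carrier Q)"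
proof -
  interpret p: group_hom G Q p using G Q p by (simp add: group_hom_def group_hom_axioms_def)
  interpret s: group_hom Q G s using G Q s by (simp add: group_hom_def group_hom_axioms_def)
  have "kernel G Q p \<inter> s ` carrier Q = {\<one>\<^bsub>G\<^esub>}"
  proof -
    have "g = \<one>\<^bsub>G\<^esub>" if "g \<in> kernel G Q p" "g \<in> s ` carrier Q" for g
    proof -
      from that(2) obtain q where q: "q \<in> carrier Q" "g = s q" by blast
      then have "q = \<one>\<^bsub>Q\<^esub>" using that(1) ps by (simp add: kernel_def)
      then show ?thesis using q by simp
    qed
    moreover have "\<one>\<^bsub>G\<^esub> \<in> kernel G Q p" by (simp add: kernel_def)
    moreover have "\<one>\<^bsub>G\<^esub> \<in> s ` carrier Q" by (rule image_eqI[of _ _ "\<one>\<^bsub>Q\<^esub>"]) simp_all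
    ultimately show ?thesis by blast
  qed
  moreover have "kernel G Q p <#>\<^bsub>G\<^esub> s ` carrier Q = carrier G"
  proof
    show "kernel G Q p <#>\<^bsub>G\<^esub> s ` carrier Q \<subseteq> carrier G"
      by (auto simp: set_mult_def kernel_def)
    show "carrier G \<subseteq> kernel G Q p <#>\<^bsub>G\<^esub> s ` carrier Q"
    proof
      fix g assume g: "g \<in> carrier G"
      let ?k = "g \<otimes>\<^bsub>G\<^esub> inv\<^bsub>G\<^esub> (s (p g))"
      have "?k \<in> kernel G Q p" using g by (simp add: kernel_def ps)
      moreover have "?k \<otimes>\<^bsub>G\<^esub> s (p g) = g" using g by (simp add: p.G.m_assoc)
      ultimately show "g \<in> kernel G Q p <#>\<^bsub>G\<^esub> s ` carrier Q"
        using p.hom_closed[OF g] unfolding set_mult_def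
        by (intro UN_I[of ?k] UN_I[of "s (p g)"]) simp_all
    qed
  qed
  ultimately show ?thesis
    by (simp add: internal_semidirect_def p.normal_kernel s.img_is_subgroup)
qed

lemma group_GLZ: "group (GLZ :: (int^'n^'n) monoid)"
proof (rule groupI)
  fix M :: "int^'n^'n" assume "M \<in> carrier GLZ"
  then obtain N where "M ** N = mat 1" "N ** M = mat 1"
    by (auto simp: GLZ_def invertible_def)
  then show "\<exists>N\<in>carrier GLZ. N \<otimes>\<^bsub>GLZ\<^esub> M = \<one>\<^bsub>GLZ\<^esub>"
    by (intro bexI[of _ N]) (auto simp: GLZ_def invertible_def)
next
  show "\<one>\<^bsub>GLZ\<^esub> \<in> carrier (GLZ :: (int^'n^'n) monoid)"
    unfolding GLZ_def invertible_def by (auto intro!: exI[of _ "mat 1"])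
qed (auto simp: GLZ_def invertible_mult matrix_mul_assoc)

lemma group_Aut: "group (Aut X)"
  unfolding Aut_def
proof (rule group.subgroup_imp_group[OF group_BijGroup], rule group.subgroupI[OF group_BijGroup])
  let ?T = "subtopology config_topology X"
  let ?A = "{H \<in> Bij X. homeomorphic_map ?T ?T H}"
  have "(\<lambda>x\<in>X. x) \<in> ?A"
    by (auto simp: id_Bij intro!: homeomorphic_map_eq[OF homeomorphic_map_id[THEN iffD2, OF refl]])
  then show "?A \<noteq> {}" by blast
  show "?A \<subseteq> carrier (BijGroup X)" by (auto simp: BijGroup_def)
  fix H assume H: "H \<in> ?A"
  then obtain K where K: "homeomorphic_maps ?T ?T H K"
    by (auto simp: homeomorphic_map_maps)
  have "K U = inv_into X H U" if "U \<in> X" for U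
  proof (rule inv_into_f_eq[symmetric])
    show "inj_on H X" using H by (simp add: Bij_def bij_betw_def)
    show "K U \<in> X" "H (K U) = U"
      using K that by (auto simp: homeomorphic_maps_def continuous_map_def)
  qed
  then have "homeomorphic_map ?T ?T (restrict (inv_into X H) X)"
    using homeomorphic_map_eq[of ?T ?T K "restrict (inv_into X H) X"]
      homeomorphic_maps_imp_map[OF K[THEN homeomorphic_maps_sym[THEN iffD1]]] by simp
  then show "inv\<^bsub>BijGroup X\<^esub> H \<in> ?A"
    using H by (simp add: inv_BijGroup restrict_inv_into_Bij)
  fix K assume K: "K \<in> ?A"
  have "homeomorphic_map ?T ?T (compose X H K)"
  proof (rule homeomorphic_map_eq)
    show "homeomorphic_map ?T ?T (H \<circ> K)"
      using H K by (intro homeomorphic_map_compose[of _ ?T]) simp_all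
  qed (simp add: compose_def)
  then show "H \<otimes>\<^bsub>BijGroup X\<^esub> K \<in> ?A"
    using H K by (simp add: BijGroup_def compose_Bij)
qed

lemma mult_Aut: "H \<in> carrier (Aut X) \<Longrightarrow> K \<in> carrier (Aut X) \<Longrightarrow> H \<otimes>\<^bsub>Aut X\<^esub> K = compose X H K"
  by (simp add: Aut_def BijGroup_def)

lemma one_Aut: "\<one>\<^bsub>Aut X\<^esub> = (\<lambda>U\<in>X. U)"
  by (simp add: Aut_def BijGroup_def)

lemma continuous_map_vimage:
  assumes "f ` X \<subseteq> X" "\<And>U. U \<in> X \<Longrightarrow> f U = h -` U"
  shows "continuous_map (subtopology config_topology X) (subtopology config_topology X) f"
  unfolding continuous_map_config_iff
proof (intro conjI allI ballI assms(1))
  fix x U assume "U \<in> X"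
  have "x \<in> f U' \<longleftrightarrow> x \<in> f U" if "U' \<in> X" "U' \<inter> {h x} = U \<inter> {h x}" for U'
  proof -
    have "h x \<in> U' \<inter> {h x} \<longleftrightarrow> h x \<in> U \<inter> {h x}" by (simp only: that(2))
    then show ?thesis using that(1) \<open>U \<in> X\<close> by (simp add: assms(2))
  qed
  then show "\<exists>F. finite F \<and> (\<forall>U'\<in>X. U' \<inter> F = U \<inter> F \<longrightarrow> (x \<in> f U') = (x \<in> f U))"
    by (intro exI[of _ "{h x}"]) simp
qed

text \<open>
  Shifts and matrices act on configurations by preimages under a map of the lattice; for such
  transformations continuity is automatic, each coordinate depending on a single other one.
\<close>

lemma restrict_in_Aut:
  assumes f: "\<And>U. U \<in> X \<Longrightarrow> f U \<in> X" "\<And>U. U \<in> X \<Longrightarrow> f U = h -` U"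
    and g: "\<And>U. U \<in> X \<Longrightarrow> g U \<in> X" "\<And>U. U \<in> X \<Longrightarrow> g U = k -` U"
    and inv: "\<And>U. U \<in> X \<Longrightarrow> g (f U) = U" "\<And>U. U \<in> X \<Longrightarrow> f (g U) = U"
  shows "restrict f X \<in> carrier (Aut X)"
proof -
  let ?T = "subtopology config_topology X"
  have "continuous_map ?T ?T (restrict f X)"
    by (rule continuous_map_vimage[where h = h]) (simp_all add: image_subset_iff f(1) f(2)[symmetric])
  moreover have "continuous_map ?T ?T (restrict g X)"
    by (rule continuous_map_vimage[where h = k]) (simp_all add: image_subset_iff g(1) g(2)[symmetric])
  ultimately have "homeomorphic_maps ?T ?T (restrict f X) (restrict g X)"
    unfolding homeomorphic_maps_def by (simp add: f(1) g(1) inv)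
  then have "homeomorphic_map ?T ?T (restrict f X)"
    by (rule homeomorphic_maps_imp_map)
  moreover have "bij_betw (restrict f X) X X"
    by (rule bij_betwI[where g = g]) (simp_all add: f(1) g(1) inv)
  ultimately show ?thesis by (simp add: Aut_def Bij_def)
qed

locale symmetric_subshift =
  fixes X :: "(int^'n) set set"
  assumes shift_closed: "U \<in> X \<Longrightarrow> shift t U \<in> X"
    and matrix_closed: "invertible M \<Longrightarrow> U \<in> X \<Longrightarrow> matrix_map M U \<in> X"
    and faithful: "(\<And>U. U \<in> X \<Longrightarrow> shift t U = U) \<Longrightarrow> t = 0"
begin

abbreviation A where "A \<equiv> Aut X"
abbreviation T where "T \<equiv> shift_on X"
abbreviation R where "R \<equiv> ext_symmetries X"

sublocale A: group A by (rule group_Aut)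

lemma T_in_Aut [simp, intro]: "T t \<in> carrier A"
  unfolding shift_on_def
  by (rule restrict_in_Aut[where g = "shift (- t)" and h = "\<lambda>x. x + t" and k = "\<lambda>x. x - t"])
    (auto simp: shift_closed shift_shift)

lemma matrix_on_in_Aut [simp, intro]:
  assumes "invertible M" shows "matrix_on X M \<in> carrier A"
proof -
  obtain N where N: "M ** N = mat 1" "N ** M = mat 1"
    using assms by (auto simp: invertible_def)
  then have "invertible N" by (auto simp: invertible_def)
  with assms N show ?thesis
    unfolding matrix_on_def
    by (intro restrict_in_Aut[where g = "matrix_map N" and h = "(*v) N" and k = "(*v) M"])
      (auto simp: matrix_closed matrix_map_mult mem_matrix_map[OF N] mem_matrix_map[OF N(2) N(1)])
qed

lemma T_add: "T s \<otimes>\<^bsub>A\<^esub> T t = T (s + t)"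
  unfolding mult_Aut[OF T_in_Aut T_in_Aut]
  by (simp add: fun_eq_iff shift_on_def compose_def restrict_def shift_closed shift_shift)

lemma T_zero: "T 0 = \<one>\<^bsub>A\<^esub>"
  by (simp add: fun_eq_iff one_Aut shift_on_def restrict_def)

lemma inv_T: "inv\<^bsub>A\<^esub> T t = T (- t)"
  by (rule A.inv_equality) (simp_all add: T_add T_zero)

lemma T_inj: "T s = T t \<longleftrightarrow> s = t"
proof
  assume "T s = T t"
  then have "T (s - t) = T 0"
    using T_add[of s "- t"] T_add[of t "- t"] by simp
  then have "shift (s - t) U = U" if "U \<in> X" for U
    using that by (auto simp: shift_on_def dest!: fun_cong[of _ _ U])
  then show "s = t" using faithful[of "s - t"] by simp
qed simp

lemma matrix_on_mult:
  "invertible M \<Longrightarrow> invertible N \<Longrightarrow> matrix_on X M \<otimes>\<^bsub>A\<^esub> matrix_on X N = matrix_on X (M ** N)"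
  unfolding mult_Aut[OF matrix_on_in_Aut matrix_on_in_Aut]
  by (simp add: fun_eq_iff matrix_on_def compose_def restrict_def matrix_closed matrix_map_mult)

lemma matrix_on_T:
  "invertible M \<Longrightarrow> matrix_on X M \<otimes>\<^bsub>A\<^esub> T t = T (M *v t) \<otimes>\<^bsub>A\<^esub> matrix_on X M"
  unfolding mult_Aut[OF matrix_on_in_Aut T_in_Aut] mult_Aut[OF T_in_Aut matrix_on_in_Aut]
  by (simp add: fun_eq_iff matrix_on_def shift_on_def compose_def restrict_def
      matrix_closed shift_closed matrix_map_shift)

lemma matrix_on_conj_T:
  assumes "invertible M"
  shows "matrix_on X M \<otimes>\<^bsub>A\<^esub> T t \<otimes>\<^bsub>A\<^esub> inv\<^bsub>A\<^esub> matrix_on X M = T (M *v t)"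
  using assms by (simp add: matrix_on_T A.m_assoc)

lemma shifts_subset: "shifts X \<subseteq> carrier A"
  by (auto simp: shifts_def)

lemma carrier_R_iff:
  "H \<in> carrier R \<longleftrightarrow> H \<in> carrier A \<and> (\<lambda>g. H \<otimes>\<^bsub>A\<^esub> g \<otimes>\<^bsub>A\<^esub> inv\<^bsub>A\<^esub> H) ` shifts X = shifts X"
  by (simp add: ext_symmetries_def A.mem_normalizer_iff[OF shifts_subset])

lemma R_simps [simp]: "mult R = mult A" "one R = one A"
  by (simp_all add: ext_symmetries_def)

lemma subgroup_R: "subgroup (carrier R) A"
  using A.normalizer_imp_subgroup[OF shifts_subset] by (simp add: ext_symmetries_def)

sublocale R: group R
  using A.subgroup_imp_group[OF subgroup_R] by (simp add: ext_symmetries_def)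

lemma R_imp_A: "H \<in> carrier R \<Longrightarrow> H \<in> carrier A"
  by (simp add: carrier_R_iff)

lemma cancel:
  assumes "H \<in> carrier A" "g \<in> carrier A"
  shows "H \<otimes>\<^bsub>A\<^esub> (inv\<^bsub>A\<^esub> H \<otimes>\<^bsub>A\<^esub> g) = g" "inv\<^bsub>A\<^esub> H \<otimes>\<^bsub>A\<^esub> (H \<otimes>\<^bsub>A\<^esub> g) = g"
  using assms by (simp_all flip: A.m_assoc)

text \<open>
  Conjugation by \<open>H\<close> is a homomorphism of the group of shifts, and \<open>n \<mapsto> T\<^sub>n\<close> is injective by
  faithfulness, so that it induces an additive self-map of the lattice.
\<close>

lemma conj_lattice_map:
  assumes "H \<in> carrier R"
  shows "\<exists>M. \<forall>n. H \<otimes>\<^bsub>A\<^esub> T n \<otimes>\<^bsub>A\<^esub> inv\<^bsub>A\<^esub> H = T (M *v n)"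
proof -
  have HA: "H \<in> carrier A" using assms R_imp_A by blast
  have "H \<otimes>\<^bsub>A\<^esub> T n \<otimes>\<^bsub>A\<^esub> inv\<^bsub>A\<^esub> H \<in> range T" for n
    using assms unfolding carrier_R_iff shifts_def by blast
  then have "\<forall>n. \<exists>m. H \<otimes>\<^bsub>A\<^esub> T n \<otimes>\<^bsub>A\<^esub> inv\<^bsub>A\<^esub> H = T m" by blast
  then obtain f where f: "\<And>n. H \<otimes>\<^bsub>A\<^esub> T n \<otimes>\<^bsub>A\<^esub> inv\<^bsub>A\<^esub> H = T (f n)"
    by metis
  have "T (f (m + n)) = T (f m + f n)" for m n
  proof -
    have "T (f m) \<otimes>\<^bsub>A\<^esub> T (f n) = H \<otimes>\<^bsub>A\<^esub> (T m \<otimes>\<^bsub>A\<^esub> T n) \<otimes>\<^bsub>A\<^esub> inv\<^bsub>A\<^esub> H"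
      unfolding f[symmetric] using HA by (simp add: A.m_assoc cancel)
    then show ?thesis by (simp add: T_add f)
  qed
  then have "\<exists>M. \<forall>n. f n = M *v n"
    by (intro additive_imp_matrix) (simp add: T_inj)
  then show ?thesis using f by metis
qed

lemma conj_matrix_exists:
  assumes H: "H \<in> carrier R"
  shows "\<exists>M. invertible M \<and> (\<forall>n. H \<otimes>\<^bsub>A\<^esub> T n \<otimes>\<^bsub>A\<^esub> inv\<^bsub>A\<^esub> H = T (M *v n))"
proof -
  have HA: "H \<in> carrier A" using H R_imp_A by blast
  have H': "inv\<^bsub>A\<^esub> H \<in> carrier R" using subgroup.m_inv_closed[OF subgroup_R H] .
  obtain M where M: "\<And>n. H \<otimes>\<^bsub>A\<^esub> T n \<otimes>\<^bsub>A\<^esub> inv\<^bsub>A\<^esub> H = T (M *v n)"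
    using conj_lattice_map[OF H] by blast
  obtain N where N: "\<And>n. inv\<^bsub>A\<^esub> H \<otimes>\<^bsub>A\<^esub> T n \<otimes>\<^bsub>A\<^esub> H = T (N *v n)"
    using conj_lattice_map[OF H'] HA by auto
  have "T (M *v (N *v n)) = T n" for n
    unfolding M[symmetric] N[symmetric] using HA by (simp add: A.m_assoc cancel)
  moreover have "T (N *v (M *v n)) = T n" for n
    unfolding M[symmetric] N[symmetric] using HA by (simp add: A.m_assoc cancel)
  ultimately have "M ** N = mat 1" "N ** M = mat 1"
    unfolding matrix_eq T_inj by (simp_all add: matrix_vector_mul_assoc)
  then show ?thesis using M by (auto simp: invertible_def)
qed

lemma psi_eqI:
  assumes "invertible M" "\<And>n. H \<otimes>\<^bsub>A\<^esub> T n \<otimes>\<^bsub>A\<^esub> inv\<^bsub>A\<^esub> H = T (M *v n)"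
  shows "psi X H = M"
  unfolding psi_def
proof (rule the_equality)
  fix N assume "invertible N \<and> (\<forall>n. H \<otimes>\<^bsub>A\<^esub> T n \<otimes>\<^bsub>A\<^esub> inv\<^bsub>A\<^esub> H = T (N *v n))"
  then have "T (N *v n) = T (M *v n)" for n using assms by simp
  then show "N = M" unfolding matrix_eq T_inj by simp
qed (use assms in simp)

lemma
  assumes "H \<in> carrier R"
  shows psi_invertible: "invertible (psi X H)"
    and psi_conj: "H \<otimes>\<^bsub>A\<^esub> T n \<otimes>\<^bsub>A\<^esub> inv\<^bsub>A\<^esub> H = T (psi X H *v n)"
  using conj_matrix_exists[OF assms] psi_eqI by metis+

lemma matrix_on_in_R:
  assumes M: "invertible M" shows "matrix_on X M \<in> carrier R"
proof -
  obtain N where N: "M ** N = mat 1" using M by (auto simp: invertible_def)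
  have "T n \<in> (\<lambda>g. matrix_on X M \<otimes>\<^bsub>A\<^esub> g \<otimes>\<^bsub>A\<^esub> inv\<^bsub>A\<^esub> matrix_on X M) ` shifts X" for n
  proof (rule image_eqI)
    show "T n = matrix_on X M \<otimes>\<^bsub>A\<^esub> T (N *v n) \<otimes>\<^bsub>A\<^esub> inv\<^bsub>A\<^esub> matrix_on X M"
      using M N by (simp add: matrix_on_conj_T matrix_vector_mul_assoc)
  qed (simp add: shifts_def)
  then show ?thesis
    using M by (auto simp: carrier_R_iff shifts_def matrix_on_conj_T)
qed

lemma psi_matrix_on: "invertible M \<Longrightarrow> psi X (matrix_on X M) = M"
  by (rule psi_eqI) (simp_all add: matrix_on_conj_T)

lemma psi_hom: "psi X \<in> hom R GLZ"
proof (rule homI)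
  fix H K assume HK: "H \<in> carrier R" "K \<in> carrier R"
  then have [simp]: "H \<in> carrier A" "K \<in> carrier A" by (simp_all add: R_imp_A)
  have "psi X (H \<otimes>\<^bsub>A\<^esub> K) = psi X H ** psi X K"
  proof (rule psi_eqI)
    show "invertible (psi X H ** psi X K)" by (simp add: HK invertible_mult psi_invertible)
    fix n
    have "H \<otimes>\<^bsub>A\<^esub> K \<otimes>\<^bsub>A\<^esub> T n \<otimes>\<^bsub>A\<^esub> inv\<^bsub>A\<^esub> (H \<otimes>\<^bsub>A\<^esub> K)
        = H \<otimes>\<^bsub>A\<^esub> (K \<otimes>\<^bsub>A\<^esub> T n \<otimes>\<^bsub>A\<^esub> inv\<^bsub>A\<^esub> K) \<otimes>\<^bsub>A\<^esub> inv\<^bsub>A\<^esub> H"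
      by (simp add: A.m_assoc A.inv_mult_group)
    also have "\<dots> = T ((psi X H ** psi X K) *v n)"
      by (simp add: psi_conj HK matrix_vector_mul_assoc)
    finally show "H \<otimes>\<^bsub>A\<^esub> K \<otimes>\<^bsub>A\<^esub> T n \<otimes>\<^bsub>A\<^esub> inv\<^bsub>A\<^esub> (H \<otimes>\<^bsub>A\<^esub> K) = T ((psi X H ** psi X K) *v n)" .
  qed
  then show "psi X (H \<otimes>\<^bsub>R\<^esub> K) = psi X H \<otimes>\<^bsub>GLZ\<^esub> psi X K" by (simp add: GLZ_def)
qed (simp add: GLZ_def psi_invertible)

lemma matrix_on_hom: "matrix_on X \<in> hom GLZ R"
  by (rule homI) (auto simp: GLZ_def matrix_on_in_R matrix_on_mult)

lemma matrix_on_mon: "matrix_on X \<in> mon GLZ R"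
  using matrix_on_hom psi_matrix_on unfolding mon_def
  by (auto intro!: inj_on_inverseI[of _ "psi X"] simp: GLZ_def)

lemma psi_epi: "psi X \<in> epi R GLZ"
proof -
  have "M \<in> psi X ` carrier R" if "invertible M" for M
    using that by (intro image_eqI[of _ _ "matrix_on X M"]) (simp_all add: psi_matrix_on matrix_on_in_R)
  then show ?thesis
    using psi_hom by (auto simp: epi_def GLZ_def psi_invertible)
qed

lemma commutes_iff_conj:
  assumes "H \<in> carrier A"
  shows "H \<otimes>\<^bsub>A\<^esub> T n = T n \<otimes>\<^bsub>A\<^esub> H \<longleftrightarrow> H \<otimes>\<^bsub>A\<^esub> T n \<otimes>\<^bsub>A\<^esub> inv\<^bsub>A\<^esub> H = T n"
  using assms by (metis A.inv_closed A.inv_solve_right' A.m_closed T_in_Aut)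

lemma mem_symmetries_iff:
  "H \<in> symmetries X \<longleftrightarrow> H \<in> carrier A \<and> (\<forall>n. H \<otimes>\<^bsub>A\<^esub> T n \<otimes>\<^bsub>A\<^esub> inv\<^bsub>A\<^esub> H = T n)"
  by (auto simp: symmetries_def centraliser_def shifts_def commutes_iff_conj)

lemma kernel_psi: "kernel R GLZ (psi X) = symmetries X"
proof -
  have "H \<in> carrier R \<and> psi X H = mat 1 \<longleftrightarrow> H \<in> symmetries X" for H
  proof
    assume "H \<in> carrier R \<and> psi X H = mat 1"
    then show "H \<in> symmetries X"
      using psi_conj[of H] by (simp add: mem_symmetries_iff R_imp_A)
  next
    assume H: "H \<in> symmetries X"
    then have "H \<in> carrier R"
      by (auto simp: mem_symmetries_iff carrier_R_iff shifts_def image_iff)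
    moreover have "psi X H = mat 1"
      using H R.one_closed by (intro psi_eqI) (auto simp: mem_symmetries_iff invertible_def intro!: exI[of _ "mat 1"])
    ultimately show "H \<in> carrier R \<and> psi X H = mat 1" by simp
  qed
  then show ?thesis by (auto simp: kernel_def GLZ_def)
qed

lemma semidirect: "internal_semidirect R (symmetries X) (matrix_on X ` carrier GLZ)"
  unfolding kernel_psi[symmetric]
  by (rule internal_semidirect_of_splitting[OF R.is_group group_GLZ psi_hom matrix_on_hom])
    (simp add: GLZ_def psi_matrix_on)

lemma shifts_subset_symmetries: "shifts X \<subseteq> symmetries X"
proof -
  have "T m \<otimes>\<^bsub>A\<^esub> T n \<otimes>\<^bsub>A\<^esub> inv\<^bsub>A\<^esub> T m = T n" for m n by (simp add: inv_T T_add)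
  then show ?thesis by (auto simp: shifts_def mem_symmetries_iff)
qed

lemma shift_on_iso:
  assumes "symmetries X = shifts X"
  shows "T \<in> iso lattice_group (A\<lparr>carrier := symmetries X\<rparr>)"
proof (rule isoI)
  show "T \<in> hom lattice_group (A\<lparr>carrier := symmetries X\<rparr>)"
    by (rule homI) (auto simp: lattice_group_def T_add assms shifts_def)
  show "bij_betw T (carrier lattice_group) (carrier (A\<lparr>carrier := symmetries X\<rparr>))"
    by (auto simp: bij_betw_def inj_on_def T_inj lattice_group_def assms shifts_def)
qed

lemma semidirect_iso:
  assumes sym: "symmetries X = shifts X"
  shows "(\<lambda>(n, M). T n \<otimes>\<^bsub>A\<^esub> matrix_on X M) \<in> iso lattice_semidirect_GLZ R" (is "?f \<in> _")
proof (rule isoI)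
  have TR: "T n \<in> carrier R" for n
    using shifts_subset_symmetries kernel_psi by (auto simp: kernel_def shifts_def)
  have in_R: "T n \<otimes>\<^bsub>A\<^esub> matrix_on X M \<in> carrier R" if "invertible M" for n M
    using R.m_closed[OF TR matrix_on_in_R[OF that]] by simp
  have psi_T: "psi X (T n) = mat 1" for n
    using shifts_subset_symmetries kernel_psi by (auto simp: kernel_def shifts_def GLZ_def)
  have psi_f: "psi X (T n \<otimes>\<^bsub>A\<^esub> matrix_on X M) = M" if "invertible M" for n M
    using hom_mult[OF psi_hom TR matrix_on_in_R[OF that], of n]
    by (simp add: psi_T psi_matrix_on that GLZ_def)
  show "?f \<in> hom lattice_semidirect_GLZ R"
  proof (rule homI)
    fix x y :: "(int^'n) \<times> (int^'n^'n)"
    assume "x \<in> carrier lattice_semidirect_GLZ" "y \<in> carrier lattice_semidirect_GLZ"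
    then obtain m M n N where xy: "x = (m, M)" "y = (n, N)" and inv: "invertible M" "invertible N"
      by (auto simp: lattice_semidirect_GLZ_def)
    have "T (m + M *v n) \<otimes>\<^bsub>A\<^esub> matrix_on X (M ** N)
        = T m \<otimes>\<^bsub>A\<^esub> ((T (M *v n) \<otimes>\<^bsub>A\<^esub> matrix_on X M) \<otimes>\<^bsub>A\<^esub> matrix_on X N)"
      using inv by (simp add: A.m_assoc matrix_on_mult invertible_mult flip: T_add)
    also have "\<dots> = (T m \<otimes>\<^bsub>A\<^esub> matrix_on X M) \<otimes>\<^bsub>A\<^esub> (T n \<otimes>\<^bsub>A\<^esub> matrix_on X N)"
      using inv by (simp add: A.m_assoc flip: matrix_on_T)
    finally show "?f (x \<otimes>\<^bsub>lattice_semidirect_GLZ\<^esub> y) = ?f x \<otimes>\<^bsub>R\<^esub> ?f y"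
      by (simp add: lattice_semidirect_GLZ_def xy)
  qed (auto simp: lattice_semidirect_GLZ_def in_R)
  show "bij_betw ?f (carrier lattice_semidirect_GLZ) (carrier R)"
  proof (rule bij_betw_imageI)
    show "inj_on ?f (carrier lattice_semidirect_GLZ)"
    proof (rule inj_onI, clarsimp simp: lattice_semidirect_GLZ_def)
      fix m n :: "int^'n" and M N :: "int^'n^'n"
      assume inv: "invertible M" "invertible N"
        and eq: "T m \<otimes>\<^bsub>A\<^esub> matrix_on X M = T n \<otimes>\<^bsub>A\<^esub> matrix_on X N"
      then have "M = N" using psi_f by metis
      with eq inv show "m = n \<and> M = N" by (simp add: T_inj)
    qed
    have "carrier R = shifts X <#>\<^bsub>R\<^esub> matrix_on X ` carrier GLZ"
      using semidirect by (simp add: internal_semidirect_def sym)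
    then show "?f ` carrier lattice_semidirect_GLZ = carrier R"
      by (force simp: lattice_semidirect_GLZ_def set_mult_def shifts_def GLZ_def)
  qed
qed

end

section \<open>Periods and symmetries of the \<open>\<B>\<close>-free points\<close>

lemma mem_multiples: "x \<in> multiples b \<longleftrightarrow> (\<forall>i. int b dvd x $ i)"
proof
  assume "\<forall>i. int b dvd x $ i"
  then have "x = int b *s (\<chi> i. x $ i div int b)" by (simp add: vec_eq_iff)
  then show "x \<in> multiples b" unfolding multiples_def by (rule range_eqI)
qed (auto simp: multiples_def)

lemma multiples_zero [simp]: "0 \<in> multiples b"
  by (simp add: mem_multiples)

lemma multiples_add: "x \<in> multiples b \<Longrightarrow> y \<in> multiples b \<Longrightarrow> x + y \<in> multiples b"
  by (simp add: mem_multiples)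

lemma multiples_diff: "x \<in> multiples b \<Longrightarrow> y \<in> multiples b \<Longrightarrow> x - y \<in> multiples b"
  by (simp add: mem_multiples)

lemma multiples_minus_commute: "x - y \<in> multiples b \<longleftrightarrow> y - x \<in> multiples b"
  by (simp add: mem_multiples dvd_diff_commute)

lemma multiples_smult: "int b dvd c \<Longrightarrow> c *s x \<in> multiples b"
  by (simp add: mem_multiples)

lemma multiples_dvd: "a dvd b \<Longrightarrow> x \<in> multiples b \<Longrightarrow> x \<in> multiples a"
  unfolding mem_multiples by (meson dvd_trans of_nat_dvd_iff)

lemma multiples_matrix: "x \<in> multiples b \<Longrightarrow> M *v x \<in> multiples b"
  by (auto simp: mem_multiples matrix_vector_mult_def intro!: dvd_sum)

lemma admissible_iff: "admissible B U \<longleftrightarrow> (\<forall>b\<in>B. \<exists>c. \<forall>x\<in>U. x - c \<notin> multiples b)"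
proof -
  have "U \<inter> (\<lambda>x. c + x) ` multiples b = {} \<longleftrightarrow> (\<forall>x\<in>U. x - c \<notin> multiples b)" for c b
  proof -
    have "x \<in> (\<lambda>x. c + x) ` multiples b \<longleftrightarrow> x - c \<in> multiples b" for x
      by (auto intro!: image_eqI[of _ _ "x - c"])
    then show ?thesis by blast
  qed
  then show ?thesis by (simp add: admissible_def)
qed

lemma admissible_subset: "admissible B U \<Longrightarrow> W \<subseteq> U \<Longrightarrow> admissible B W"
  unfolding admissible_iff by blast

lemma mem_bfree_points: "x \<in> bfree_points B \<longleftrightarrow> (\<forall>b\<in>B. x \<notin> multiples b)"
  by (auto simp: bfree_points_def)

lemma bfree_points_matrix:
  assumes "N ** M = mat 1"
  shows "M *v x \<in> bfree_points B \<longleftrightarrow> x \<in> bfree_points B"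
proof -
  have "M *v x \<in> multiples b \<longleftrightarrow> x \<in> multiples b" for b
    using multiples_matrix[of x b M] multiples_matrix[of "M *v x" b N] assms
    by (auto simp: matrix_vector_mul_assoc)
  then show ?thesis by (simp add: mem_bfree_points)
qed

lemma mem_bfree_system:
  "U \<in> bfree_system B \<longleftrightarrow> (\<forall>F. finite F \<longrightarrow> (\<exists>t. \<forall>x\<in>F. x \<in> U \<longleftrightarrow> x + t \<in> bfree_points B))"
proof -
  have mem: "x \<in> (\<lambda>x. t + x) ` bfree_points B \<longleftrightarrow> x + (- t) \<in> bfree_points B" for x t
    by (auto intro!: image_eqI[of _ _ "x - t"])
  have "(\<exists>W\<in>range (\<lambda>t. (\<lambda>x. t + x) ` bfree_points B). W \<inter> F = U \<inter> F) \<longleftrightarrow>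
      (\<exists>t. \<forall>x\<in>F. x \<in> U \<longleftrightarrow> x + t \<in> bfree_points B)" (is "?L \<longleftrightarrow> ?R") for F
  proof
    assume ?L
    then obtain t where "(\<lambda>x. t + x) ` bfree_points B \<inter> F = U \<inter> F" by auto
    then have "\<forall>x\<in>F. x \<in> U \<longleftrightarrow> x \<in> (\<lambda>x. t + x) ` bfree_points B" by blast
    then show ?R unfolding mem by (intro exI[of _ "- t"])
  next
    assume ?R
    then obtain t where t: "\<forall>x\<in>F. x \<in> U \<longleftrightarrow> x + t \<in> bfree_points B" by blast
    then have "\<forall>x\<in>F. x \<in> U \<longleftrightarrow> x \<in> (\<lambda>x. - t + x) ` bfree_points B" unfolding mem by simp
    then have "(\<lambda>x. - t + x) ` bfree_points B \<inter> F = U \<inter> F" by blast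
    then show ?L by (rule rev_bexI[OF rangeI])
  qed
  then show ?thesis by (simp add: bfree_system_def in_config_closure_iff)
qed

lemma bfree_points_in_system: "bfree_points B \<in> bfree_system B"
  unfolding mem_bfree_system by (auto intro!: exI[of _ 0])

text \<open>
  Let \<open>t = g y\<close> with \<open>g\<close> the greatest common divisor of the
  coordinates, and let \<open>b \<in> B\<close> exceed \<open>g\<close>. A multiple of the period \<open>t\<close> moves the point \<open>u b y\<close>, which is not
  \<open>B\<close>-free, to \<open>h y\<close> with \<open>h = gcd b g\<close>. Hence some \<open>a \<in> B\<close> divides \<open>h\<close>, a divisor of \<open>b\<close>, and
  primitivity yields \<open>a = b\<close>, so that \<open>b\<close> divides the smaller number \<open>g\<close>.
\<close>

lemma bfree_points_aperiodic:
  fixes t :: "int^'n"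
  assumes B: "infinite B" "primitive B"
    and per: "\<And>x. x + t \<in> bfree_points B \<longleftrightarrow> x \<in> bfree_points B"
  shows "t = 0"
proof (rule ccontr)
  assume "t \<noteq> 0"
  define g where "g = Gcd (range (($) t))"
  have "g \<noteq> 0" using \<open>t \<noteq> 0\<close> by (auto simp: g_def vec_eq_iff)
  moreover have "g \<ge> 0" by (simp add: g_def)
  ultimately have g: "g > 0" by simp
  define y where "y = (\<chi> i. t $ i div g)"
  have t: "t = g *s y" by (simp add: vec_eq_iff y_def g_def)
  have per_nat: "x + int k *s t \<in> bfree_points B \<longleftrightarrow> x \<in> bfree_points B" for x k
  proof (induction k)
    case (Suc k)
    have "x + int (Suc k) *s t = x + int k *s t + t" by (simp add: vec_eq_iff algebra_simps)
    then show ?case by (simp only: per Suc)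
  qed simp
  have per_int: "x + k *s t \<in> bfree_points B \<longleftrightarrow> x \<in> bfree_points B" for x k
  proof (cases k rule: int_cases2)
    case (nonpos n)
    have "x = x + k *s t + int n *s t" by (simp add: nonpos vec_eq_iff)
    then show ?thesis using per_nat by metis
  qed (simp add: per_nat)
  obtain b where b: "b \<in> B" "b > nat g"
    using B(1) unfolding infinite_nat_iff_unbounded by blast
  define h where "h = gcd (int b) g"
  obtain u v where uv: "u * int b + v * g = h"
    using bezout_int[of "int b" g] by (auto simp: h_def)
  \<comment> \<open>the point \<open>h y\<close> differs from a point of \<open>b\<int>\<^sup>d\<close> by a multiple of the period\<close>
  have "(u * int b) *s y \<notin> bfree_points B"
    using b(1) multiples_smult[of b "u * int b" y] by (auto simp: mem_bfree_points)
  moreover have "h *s y = (u * int b) *s y + v *s t"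
    by (simp add: t uv[symmetric] vec_eq_iff algebra_simps)
  ultimately have "h *s y \<notin> bfree_points B" using per_int by simp
  then obtain a where a: "a \<in> B" "h *s y \<in> multiples a" by (auto simp: mem_bfree_points)
  have "int a * g dvd h * t $ i" for i
    using a(2) by (simp add: mem_multiples t algebra_simps)
  then have "int a * g dvd Gcd ((*) h ` range (($) t))" by (auto intro!: Gcd_greatest)
  then have "int a * g dvd h * g" by (simp add: Gcd_mult g_def)
  then have "int a dvd h" using g by simp
  then have "a dvd b" by (metis dvd_trans gcd_dvd1 h_def of_nat_dvd_iff)
  then have "a = b" using B(2) a(1) b(1) by (simp add: primitive_def)
  then have "int b dvd g" using \<open>int a dvd h\<close> by (metis dvd_trans gcd_dvd2 h_def)
  then have "int b \<le> g" using g by (rule zdvd_imp_le)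
  then show False using b(2) by simp
qed

lemma symmetric_subshift_bfree_system:
  assumes "infinite B" "primitive B"
  shows "symmetric_subshift (bfree_system B :: (int^'n) set set)"
proof
  fix U :: "(int^'n) set" and s
  assume U: "U \<in> bfree_system B"
  show "shift s U \<in> bfree_system B"
    unfolding mem_bfree_system
  proof (intro allI impI)
    fix F :: "(int^'n) set" assume "finite F"
    then have "finite ((\<lambda>x. x + s) ` F)" by simp
    then obtain t where "\<forall>x\<in>(\<lambda>x. x + s) ` F. x \<in> U \<longleftrightarrow> x + t \<in> bfree_points B"
      using U unfolding mem_bfree_system by blast
    then show "\<exists>t. \<forall>x\<in>F. x \<in> shift s U \<longleftrightarrow> x + t \<in> bfree_points B"
      by (intro exI[of _ "s + t"]) (simp add: add.assoc)
  qed
next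
  fix U :: "(int^'n) set" and M :: "int^'n^'n"
  assume M: "invertible M" and U: "U \<in> bfree_system B"
  then obtain N where N: "M ** N = mat 1" "N ** M = mat 1"
    by (auto simp: invertible_def)
  show "matrix_map M U \<in> bfree_system B"
    unfolding mem_bfree_system
  proof (intro allI impI)
    fix F :: "(int^'n) set" assume "finite F"
    then have "finite ((\<lambda>x. N *v x) ` F)" by simp
    then obtain t where t: "\<forall>x\<in>(\<lambda>x. N *v x) ` F. x \<in> U \<longleftrightarrow> x + t \<in> bfree_points B"
      using U unfolding mem_bfree_system by blast
    have "x \<in> matrix_map M U \<longleftrightarrow> x + M *v t \<in> bfree_points B" if "x \<in> F" for x
    proof -
      have "x + M *v t = M *v (N *v x + t)"
        by (simp add: matrix_vector_right_distrib matrix_vector_mul_assoc N)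
      then show ?thesis
        using t that by (simp add: mem_matrix_map[OF N] bfree_points_matrix[OF N(2)])
    qed
    then show "\<exists>t. \<forall>x\<in>F. x \<in> matrix_map M U \<longleftrightarrow> x + t \<in> bfree_points B" by blast
  qed
next
  fix t :: "int^'n"
  assume "\<And>U. U \<in> bfree_system B \<Longrightarrow> shift t U = U"
  then have "shift t (bfree_points B) = bfree_points B"
    using bfree_points_in_system by blast
  then have "x + t \<in> bfree_points B \<longleftrightarrow> x \<in> bfree_points B" for x
    by (metis mem_shift)
  then show "t = 0" by (rule bfree_points_aperiodic[OF assms])
qed

lemma
  fixes A :: "'n::finite \<Rightarrow> 'a set"
  assumes "\<And>i. finite (A i)"
  shows finite_vec_box: "finite {c::'a^'n. \<forall>i. c $ i \<in> A i}"
    and card_vec_box: "card {c::'a^'n. \<forall>i. c $ i \<in> A i} = (\<Prod>i\<in>UNIV. card (A i))"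
proof -
  have eq: "{c::'a^'n. \<forall>i. c $ i \<in> A i} = vec_lambda ` PiE UNIV A"
  proof safe
    fix c :: "'a^'n" assume "\<forall>i. c $ i \<in> A i"
    then show "c \<in> vec_lambda ` PiE UNIV A"
      by (intro image_eqI[of _ _ "($) c"]) (auto simp: vec_lambda_eta)
  qed (auto simp: PiE_iff)
  show "finite {c::'a^'n. \<forall>i. c $ i \<in> A i}" unfolding eq by (simp add: finite_PiE assms)
  have "inj_on vec_lambda (PiE UNIV A)" by (rule inj_on_subset[of _ UNIV]) (auto simp: inj_def vec_lambda_inject)
  then show "card {c::'a^'n. \<forall>i. c $ i \<in> A i} = (\<Prod>i\<in>UNIV. card (A i))"
    unfolding eq by (simp add: card_image card_PiE)
qed

lemma residue_box:
  assumes "b > 0"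
  shows "finite {c::int^'n. \<forall>i. c $ i \<in> {0..<int b}}"
    and "\<exists>c\<in>{c::int^'n. \<forall>i. c $ i \<in> {0..<int b}}. y - c \<in> multiples b"
proof -
  show "finite {c::int^'n. \<forall>i. c $ i \<in> {0..<int b}}" by (rule finite_vec_box) simp
  show "\<exists>c\<in>{c::int^'n. \<forall>i. c $ i \<in> {0..<int b}}. y - c \<in> multiples b"
    by (rule bexI[of _ "\<chi> i. y $ i mod int b"]) (use assms in \<open>auto simp: mem_multiples\<close>)
qed

text \<open>
  If \<open>U\<close> met every class modulo \<open>b\<close>, then so would a finite part of \<open>U\<close>, which occurs in a
  translate of the set of \<open>B\<close>-free points; but this translate misses a coset of \<open>b\<int>\<^sup>d\<close>.
\<close>

lemma bfree_system_imp_admissible: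
  fixes U :: "(int^'n) set"
  assumes pos: "\<forall>b\<in>B. b > 0" and U: "U \<in> bfree_system B"
  shows "admissible B U"
proof (rule ccontr)
  assume "\<not> admissible B U"
  then obtain b where b: "b \<in> B" and "\<forall>c. \<exists>x\<in>U. x - c \<in> multiples b"
    by (auto simp: admissible_iff)
  then obtain f where f: "\<And>c. f c \<in> U" "\<And>c. f c - c \<in> multiples b" by metis
  let ?C = "{c::int^'n. \<forall>i. c $ i \<in> {0..<int b}}"
  have b0: "b > 0" using pos b by blast
  have "finite (f ` ?C)" by (rule finite_imageI[OF residue_box(1)[OF b0]])
  then obtain t where t: "\<forall>x\<in>f ` ?C. x \<in> U \<longleftrightarrow> x + t \<in> bfree_points B"
    using U unfolding mem_bfree_system by blast
  obtain c where c: "c \<in> ?C" "- t - c \<in> multiples b" using residue_box(2)[OF b0] by blast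
  then have "f c + t \<in> bfree_points B" using bspec[OF t imageI[OF c(1)]] f(1)[of c] by simp
  then have "f c + t \<notin> multiples b" using b by (simp add: mem_bfree_points)
  moreover have "f c + t \<in> multiples b"
    using multiples_diff[OF f(2)[of c] c(2)] by (simp add: algebra_simps)
  ultimately show False by contradiction
qed

section \<open>Block codes on admissible sets\<close>

lemma crt_vec:
  fixes r s :: "int^'n"
  assumes "coprime a b"
  shows "\<exists>x. x - r \<in> multiples a \<and> x - s \<in> multiples b"
proof -
  obtain u v where uv: "u * int a + v * int b = 1"
    using bezout_int[of "int a" "int b"] assms by auto
  let ?x = "r + (u * int a) *s (s - r)"
  have "?x - r = (u * int a) *s (s - r)" by simp
  then have "?x - r \<in> multiples a" by (simp only:) (rule multiples_smult, simp)
  moreover have "?x - s = (v * int b) *s (r - s)"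
  proof -
    have "v * int b = 1 - u * int a" using uv by simp
    then show ?thesis by (simp only: vec_eq_iff) (simp add: algebra_simps)
  qed
  then have "?x - s \<in> multiples b" by (simp only:) (rule multiples_smult, simp)
  ultimately show ?thesis by blast
qed

lemma multiples_infinite:
  assumes "b > 0" shows "infinite (multiples b :: (int^'n) set)"
proof -
  have "inj (\<lambda>k. int b *s vec (int k) :: int^'n)"
    using assms by (auto simp: inj_def vec_eq_iff)
  then have "infinite (range (\<lambda>k. int b *s vec (int k) :: int^'n))"
    by (rule range_inj_infinite)
  moreover have "range (\<lambda>k. int b *s vec (int k) :: int^'n) \<subseteq> multiples b"
    by (auto simp: multiples_def)
  ultimately show ?thesis using finite_subset by blast
qed

lemma crt_vec_avoiding:
  fixes r s :: "int^'n"
  assumes "coprime a b" "a > 0" "b > 0" "finite E"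
  obtains x where "x \<notin> E" "x - r \<in> multiples a" "x - s \<in> multiples b"
proof -
  obtain y where y: "y - r \<in> multiples a" "y - s \<in> multiples b"
    using crt_vec[OF assms(1)] by blast
  have "finite ((\<lambda>e. e - y) ` E)" using assms(4) by simp
  then obtain z where z: "z \<in> multiples (a * b)" "z \<notin> (\<lambda>e. e - y) ` E"
    using multiples_infinite[of "a * b"] assms(2,3) by (metis finite_subset nat_0_less_mult_iff subsetI)
  have "y + z \<notin> E" using z(2) by (auto simp: image_iff)
  moreover have "y + z - r \<in> multiples a"
    using multiples_add[OF y(1) multiples_dvd[OF _ z(1)]] by (simp add: algebra_simps)
  moreover have "y + z - s \<in> multiples b"
    using multiples_add[OF y(2) multiples_dvd[OF _ z(1)]] by (simp add: algebra_simps)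
  ultimately show ?thesis by (rule that)
qed

lemma small_set_misses_residue:
  fixes U :: "(int^'n) set"
  assumes "finite U" "card U < b"
  shows "\<exists>c. \<forall>x\<in>U. x - c \<notin> multiples b"
proof -
  let ?f = "\<lambda>x::int^'n. nat (x $ undefined mod int b)"
  have "card (?f ` U) < card {..<b}"
    using card_image_le[OF assms(1), of ?f] assms(2) by simp
  then obtain k where k: "k < b" "k \<notin> ?f ` U"
    by (metis assms(1) card_mono finite_imageI lessThan_iff linorder_not_less subsetI)
  have "x - vec (int k) \<notin> multiples b" if "x \<in> U" for x
  proof
    assume "x - vec (int k) \<in> multiples b"
    then have "int b dvd x $ undefined - int k" by (simp add: mem_multiples)
    then have "x $ undefined mod int b = int k mod int b" by (simp add: mod_eq_dvd_iff)
    then have "k = ?f x" using k(1) by simp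
    then show False using k(2) that by blast
  qed
  then show ?thesis by blast
qed

lemma multiples_large:
  fixes D :: "(int^'n) set"
  assumes "finite D" "0 \<notin> D"
  obtains N where "\<And>x b. x \<in> D \<Longrightarrow> b > N \<Longrightarrow> x \<notin> multiples b"
proof -
  define N where "N = Max (insert 0 ((\<lambda>(x, i). nat \<bar>x $ i\<bar>) ` (D \<times> UNIV)))"
  have N: "nat \<bar>x $ i\<bar> \<le> N" if "x \<in> D" for x i
    unfolding N_def by (rule Max_ge) (use assms that in \<open>auto intro!: image_eqI[of _ _ "(x, i)"]\<close>)
  have "x \<notin> multiples b" if x: "x \<in> D" and b: "b > N" for x b
  proof
    assume "x \<in> multiples b"
    then have "int b dvd x $ i" for i by (simp add: mem_multiples)
    moreover have "\<bar>x $ i\<bar> < int b" for i using N[OF x, of i] b by linarith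
    ultimately have "x $ i = 0" for i
      using zdvd_not_zless[of "\<bar>x $ i\<bar>" "int b"] by (meson abs_ge_zero dvd_abs_iff order_le_less zero_less_abs_iff)
    then have "x = 0" by (simp add: vec_eq_iff)
    then show False using x assms(2) by simp
  qed
  then show ?thesis by (rule that)
qed

text \<open>
  Representatives of prescribed classes modulo \<open>b\<close> can be taken in one class modulo a coprime number
  \<open>a\<close> and one after the other, each outside a finite set that depends on the earlier ones. The
  property \<open>\<Phi>\<close> expresses what such generic choices achieve.
\<close>

lemma generic_representatives:
  fixes R :: "(int^'n) set"
  assumes "finite R" "coprime a b" "a > 0" "b > 0"
    and "\<Phi> {}" and step: "\<And>W. finite W \<Longrightarrow> \<Phi> W \<Longrightarrow> \<exists>E. finite E \<and> (\<forall>w. w \<notin> E \<longrightarrow> \<Phi> (insert w W))"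
  shows "\<exists>W. finite W \<and> card W \<le> card R \<and> \<Phi> W \<and> (\<forall>w\<in>W. w - u \<in> multiples a) \<and>
    (\<forall>w\<in>W. \<exists>r\<in>R. w - r \<in> multiples b) \<and> (\<forall>r\<in>R. \<exists>w\<in>W. w - r \<in> multiples b)"
  using assms(1)
proof induction
  case empty
  then show ?case using assms(5) by (intro exI[of _ "{}"]) simp
next
  case (insert r R)
  then obtain W where W: "finite W" "card W \<le> card R" "\<Phi> W" "\<forall>w\<in>W. w - u \<in> multiples a"
    "\<forall>w\<in>W. \<exists>r\<in>R. w - r \<in> multiples b" "\<forall>r\<in>R. \<exists>w\<in>W. w - r \<in> multiples b" by blast
  obtain E where E: "finite E" "\<And>w. w \<notin> E \<Longrightarrow> \<Phi> (insert w W)"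
    using step[OF W(1,3)] by blast
  obtain w where w: "w \<notin> E" "w - u \<in> multiples a" "w - r \<in> multiples b"
    using crt_vec_avoiding[OF assms(2-4) E(1)] by blast
  have "card (insert w W) \<le> card (insert r R)"
    using W(1,2) insert(1,2) by (simp add: card_insert_if)
  then show ?case
    using W w E(2) by (intro exI[of _ "insert w W"]) simp
qed

text \<open>
  A sliding block code on the admissible sets, with window \<open>F\<close>. A homeomorphism that commutes with
  the shifts and its inverse both give rise to such a code.
\<close>

locale admissible_code =
  fixes B :: "nat set" and H :: "(int^'n) set \<Rightarrow> (int^'n) set" and F :: "(int^'n) set"
  assumes B_infinite: "infinite B" and B_coprime: "pairwise coprime B"
    and B_ge2: "b \<in> B \<Longrightarrow> b \<ge> 2"
    and H_admissible: "admissible B U \<Longrightarrow> admissible B (H U)"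
    and H_shift: "admissible B U \<Longrightarrow> H (shift n U) = shift n (H U)"
    and F_finite: "finite F"
    and H_window: "admissible B U \<Longrightarrow> admissible B U' \<Longrightarrow> U' \<inter> F = U \<inter> F \<Longrightarrow> 0 \<in> H U' \<longleftrightarrow> 0 \<in> H U"
begin

lemma admissible_shift: "admissible B U \<Longrightarrow> admissible B (shift n U)"
  unfolding admissible_iff
proof (intro ballI)
  fix b assume "\<forall>b\<in>B. \<exists>c. \<forall>x\<in>U. x - c \<notin> multiples b" "b \<in> B"
  then obtain c where c: "\<forall>x\<in>U. x - c \<notin> multiples b" by blast
  have "x - (c - n) \<notin> multiples b" if "x \<in> shift n U" for x
    using that c[rule_format, of "x + n"] by (simp add: algebra_simps)
  then show "\<exists>c. \<forall>x\<in>shift n U. x - c \<notin> multiples b" by blast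
qed

lemma code:
  assumes "admissible B U" "admissible B U'" "\<And>f. f \<in> F \<Longrightarrow> n + f \<in> U' \<longleftrightarrow> n + f \<in> U"
  shows "n \<in> H U' \<longleftrightarrow> n \<in> H U"
proof -
  have "f \<in> shift n U' \<longleftrightarrow> f \<in> shift n U" if "f \<in> F" for f
    using assms(3)[OF that] by (simp add: add.commute)
  then have "shift n U' \<inter> F = shift n U \<inter> F" by blast
  then have "0 \<in> H (shift n U') \<longleftrightarrow> 0 \<in> H (shift n U)"
    by (rule H_window[OF admissible_shift[OF assms(1)] admissible_shift[OF assms(2)]])
  then show ?thesis by (simp add: H_shift assms)
qed

lemma admissible_singleton: "admissible B {w}"
  unfolding admissible_iff
proof
  fix b assume "b \<in> B"
  then have "card {w} < b" using B_ge2[of b] by simp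
  then show "\<exists>c. \<forall>x\<in>{w}. x - c \<notin> multiples b"
    by (rule small_set_misses_residue[rotated]) simp
qed

lemma admissible_empty: "admissible B {}"
  by (rule admissible_subset[OF admissible_singleton]) simp

text \<open>
  The image of the empty set is invariant under all shifts, and the whole lattice is not admissible.
\<close>

lemma H_empty: "H {} = {}"
proof (rule ccontr)
  assume "H {} \<noteq> {}"
  then obtain x where x: "x \<in> H {}" by blast
  have "shift n (H {}) = H {}" for n
    using H_shift[OF admissible_empty, of n] by (simp add: shift_def)
  then have "y \<in> H {}" for y
    using x by (metis add.commute diff_add_cancel mem_shift)
  moreover obtain b where "b \<in> B" using B_infinite by fastforce
  ultimately show False
    using H_admissible[OF admissible_empty] unfolding admissible_iff by (metis diff_self multiples_zero)
qed

lemma H_singleton: "n \<in> H {w} \<longleftrightarrow> n - w \<in> H {0}"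
proof -
  have "shift w {w} = {0}" by (auto simp: shift_def)
  then have "H {0} = shift w (H {w})" by (metis H_shift admissible_singleton)
  then show ?thesis by simp
qed

text \<open>
  No translate of the window sees both \<open>w\<close> and a point of \<open>U\<close>.
\<close>

lemma H_insert_far:
  assumes adm: "admissible B (insert w U)"
    and far: "\<And>f g. f \<in> F \<Longrightarrow> g \<in> F \<Longrightarrow> w - f + g \<notin> U"
  shows "H (insert w U) = H U \<union> H {w}"
proof (rule Set.set_eqI)
  fix n
  have U: "admissible B U" by (rule admissible_subset[OF adm]) blast
  show "n \<in> H (insert w U) \<longleftrightarrow> n \<in> H U \<union> H {w}"
  proof (cases "\<exists>f\<in>F. n + f = w")
    case True
    then have notU: "n + g \<notin> U" if "g \<in> F" for g
      using far[OF _ that] by fastforce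
    have "n \<in> H (insert w U) \<longleftrightarrow> n \<in> H {w}"
      by (rule code[OF admissible_singleton adm]) (use notU in auto)
    moreover have "n \<in> H U \<longleftrightarrow> n \<in> H {}"
      by (rule code[OF admissible_empty U]) (use notU in auto)
    ultimately show ?thesis by (simp add: H_empty)
  next
    case False
    have "n \<in> H (insert w U) \<longleftrightarrow> n \<in> H U"
      by (rule code[OF U adm]) (use False in auto)
    moreover have "n \<in> H {w} \<longleftrightarrow> n \<in> H {}"
      by (rule code[OF admissible_empty admissible_singleton]) (use False in auto)
    ultimately show ?thesis by (simp add: H_empty)
  qed
qed

text \<open>
  A finite set \<open>W\<close>, with points far from \<open>U\<close> and from each other, is added to \<open>U\<close>, so that
  \<open>H(U \<union> W)\<close> contains \<open>W + p\<close> for each \<open>p \<in> H({0})\<close>. It represents all classes modulo \<open>b\<close> except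
  that of \<open>c\<close>, so the one class \<open>m\<close> missed by \<open>H(U \<union> W)\<close> can only be that of \<open>c + p\<close>.
  To keep \<open>U \<union> W\<close> admissible, \<open>W\<close> lies in the class of a point \<open>u \<in> U\<close> modulo each small element of
  \<open>B\<close> other than \<open>b\<close>; modulo a large one there are too few points to meet all classes.
\<close>

lemma missed_residue:
  assumes U: "admissible B U" "finite U" "U \<noteq> {}" and b: "b \<in> B"
    and c: "\<forall>x\<in>U. x - c \<notin> multiples b"
  obtains m where "\<forall>x\<in>H U. x - m \<notin> multiples b" "\<forall>p\<in>H {0}. m - (c + p) \<in> multiples b"
proof -
  obtain u where u: "u \<in> U" using U(3) by blast
  define R where "R = {r::int^'n. \<forall>i. r $ i \<in> {0..<int b}} - {r. r - c \<in> multiples b}"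
  have b0: "b > 0" using B_ge2[OF b] by simp
  have R: "finite R" unfolding R_def using residue_box(1)[OF b0] by (rule finite_Diff)
  \<comment> \<open>\<open>U \<union> W\<close> will have at most \<open>K\<close> points, so it misses a class modulo each larger number\<close>
  define K where "K = card U + card R"
  define S where "S = {a \<in> B. a \<le> K \<and> a \<noteq> b}"
  have S: "finite S" unfolding S_def by (rule finite_subset[of _ "{..K}"]) auto
  have "coprime (\<Prod>S) b"
  proof (rule prod_coprime_left)
    fix a assume "a \<in> S"
    then show "coprime a b"
      using B_coprime b by (auto simp: S_def pairwise_def)
  qed
  moreover have "\<Prod>S > 0"
    using B_ge2 by (force simp: S_def intro!: prod_pos)
  moreover define \<Phi> where "\<Phi> W \<longleftrightarrow> (admissible B (U \<union> W) \<longrightarrow> H (U \<union> W) = H U \<union> (\<Union>w\<in>W. H {w}))" for W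
  have "\<Phi> {}" by (simp add: \<Phi>_def)
  moreover have "\<exists>E. finite E \<and> (\<forall>w. w \<notin> E \<longrightarrow> \<Phi> (insert w W))" if W: "finite W" "\<Phi> W" for W
  proof (intro exI conjI allI impI)
    \<comment> \<open>outside this set, no translate of the window meets both \<open>w\<close> and \<open>U \<union> W\<close>\<close>
    let ?E = "(\<lambda>(x, f, g). x + f - g) ` ((U \<union> W) \<times> F \<times> F)"
    show "finite ?E" using W U F_finite by blast
    fix w assume w: "w \<notin> ?E"
    have far: "w - f + g \<notin> U \<union> W" if "f \<in> F" "g \<in> F" for f g
    proof
      assume "w - f + g \<in> U \<union> W"
      then have "(w - f + g, f, g) \<in> (U \<union> W) \<times> F \<times> F" using that by blast
      then have "(\<lambda>(x, f, g). x + f - g) (w - f + g, f, g) \<in> ?E" by (rule imageI)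
      then show False using w by simp
    qed
    show "\<Phi> (insert w W)" unfolding \<Phi>_def
    proof
      assume adm: "admissible B (U \<union> insert w W)"
      then have "admissible B (U \<union> W)" by (rule admissible_subset) blast
      then have "H (U \<union> W) = H U \<union> (\<Union>w\<in>W. H {w})" using W(2) by (simp add: \<Phi>_def)
      moreover have "H (insert w (U \<union> W)) = H (U \<union> W) \<union> H {w}"
        using adm far by (intro H_insert_far) simp_all
      ultimately show "H (U \<union> insert w W) = H U \<union> (\<Union>w\<in>insert w W. H {w})" by auto
    qed
  qed
  ultimately obtain W where W: "finite W" "card W \<le> card R" "\<Phi> W" "\<forall>w\<in>W. w - u \<in> multiples (\<Prod>S)"
    "\<forall>w\<in>W. \<exists>r\<in>R. w - r \<in> multiples b" "\<forall>r\<in>R. \<exists>w\<in>W. w - r \<in> multiples b"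
    using generic_representatives[OF R _ _ b0, of "\<Prod>S" \<Phi> u] by metis
  have Wc: "w - c \<notin> multiples b" if w: "w \<in> W" for w
  proof
    assume wc: "w - c \<in> multiples b"
    obtain r where r: "r \<in> R" "w - r \<in> multiples b" using bspec[OF W(5) w] by blast
    have "r - c \<in> multiples b" using multiples_diff[OF wc r(2)] by simp
    then show False using r(1) by (simp add: R_def)
  qed
  have adm: "admissible B (U \<union> W)"
    unfolding admissible_iff
  proof
    fix a assume a: "a \<in> B"
    consider "a = b" | "a > K" | "a \<in> S" using a by (force simp: S_def)
    then show "\<exists>c. \<forall>x\<in>U \<union> W. x - c \<notin> multiples a"
    proof cases
      case 1
      then show ?thesis using c Wc by blast
    next
      case 2
      have "card (U \<union> W) \<le> K" using card_Un_le[of U W] W(2) by (simp add: K_def)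
      with 2 show ?thesis by (intro small_set_misses_residue) (use U W in auto)
    next
      case 3
      obtain e where e: "\<forall>x\<in>U. x - e \<notin> multiples a" using U(1) a by (auto simp: admissible_iff)
      have "w - e \<notin> multiples a" if "w \<in> W" for w
      proof
        assume we: "w - e \<in> multiples a"
        have "w - u \<in> multiples a"
          by (rule multiples_dvd[OF dvd_prodI[OF S 3] bspec[OF W(4) that]])
        then have "u - e \<in> multiples a" using multiples_diff[OF we] by force
        then show False using e u by blast
      qed
      then show ?thesis using e by blast
    qed
  qed
  then have HUW: "H (U \<union> W) = H U \<union> (\<Union>w\<in>W. H {w})" using W(3) by (simp add: \<Phi>_def)
  obtain m where m: "\<And>x. x \<in> H (U \<union> W) \<Longrightarrow> x - m \<notin> multiples b"
    using H_admissible[OF adm, unfolded admissible_iff, rule_format, OF b] by blast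
  show ?thesis
  proof (rule that)
    show "\<forall>x\<in>H U. x - m \<notin> multiples b" using m HUW by blast
    show "\<forall>p\<in>H {0}. m - (c + p) \<in> multiples b"
    proof (rule ballI, rule ccontr)
      fix p assume p: "p \<in> H {0}" and "m - (c + p) \<notin> multiples b"
      then have mp: "m - p - c \<notin> multiples b" by (simp add: algebra_simps)
      obtain r where r: "\<forall>i. r $ i \<in> {0..<int b}" "m - p - r \<in> multiples b"
        using residue_box(2)[OF b0, of "m - p"] by blast
      have "r - c \<notin> multiples b"
      proof
        assume "r - c \<in> multiples b"
        then have "(m - p - r) + (r - c) \<in> multiples b" by (rule multiples_add[OF r(2)])
        moreover have "(m - p - r) + (r - c) = m - p - c" by simp
        ultimately show False using mp by simp
      qed
      then have "r \<in> R" using r(1) by (simp add: R_def)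
      then obtain w where w: "w \<in> W" "w - r \<in> multiples b" using W(6) by blast
      have "w + p \<in> H {w}" using p H_singleton[of "w + p" w] by simp
      then have "w + p - m \<notin> multiples b" using m HUW w(1) by blast
      moreover have "w + p - m \<in> multiples b"
        using multiples_diff[OF w(2) r(2)] by (simp add: algebra_simps)
      ultimately show False by contradiction
    qed
  qed
qed

text \<open>
  If \<open>x \<in> H(U)\<close> but \<open>x - p \<notin> U\<close>, then \<open>U\<close> misses the class of \<open>x - p\<close> modulo a large \<open>b\<close>, and so
  \<open>H(U)\<close> misses the class of \<open>x\<close>.
\<close>

lemma H_finite_subset:
  assumes p: "p \<in> H {0}" and U: "finite U" "admissible B U"
  shows "H U \<subseteq> shift (- p) U"
proof (cases "U = {}")
  case False
  show ?thesis
  proof (rule subsetI, rule ccontr)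
    fix x assume x: "x \<in> H U" "x \<notin> shift (- p) U"
    then have "0 \<notin> (\<lambda>u. u - (x - p)) ` U" by (auto simp: algebra_simps)
    then obtain N where N: "\<And>y b. y \<in> (\<lambda>u. u - (x - p)) ` U \<Longrightarrow> b > N \<Longrightarrow> y \<notin> multiples b"
      using multiples_large[of "(\<lambda>u. u - (x - p)) ` U"] U(1) by blast
    obtain b where b: "b \<in> B" "b > N"
      using B_infinite unfolding infinite_nat_iff_unbounded by blast
    then have "\<forall>u\<in>U. u - (x - p) \<notin> multiples b" using N by blast
    from missed_residue[OF U(2,1) False b(1) this]
    obtain m where m: "\<forall>x\<in>H U. x - m \<notin> multiples b"
      "\<forall>q\<in>H {0}. m - ((x - p) + q) \<in> multiples b" by blast
    have "m - x \<in> multiples b" using m(2) p by fastforce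
    then show False using m(1) x(1) multiples_minus_commute by blast
  qed
qed (simp add: H_empty)

end

text \<open>
  For finite \<open>U\<close>, the block codes of \<open>H\<close> and of its inverse yield \<open>H(U) \<subseteq> U + p\<close> and
  \<open>U \<subseteq> H(U) + q\<close>. Here \<open>p \<in> H({0})\<close> and \<open>q \<in> H\<^sup>-\<^sup>1({0})\<close> exist because \<open>H\<close> is injective and
  fixes the empty set, and \<open>q = - p\<close> as follows from \<open>H({0}) = {p}\<close>. A general \<open>U\<close> is reduced to its
  intersections with translated windows, which are admissible sets again.
\<close>

theorem symmetries_admissible:
  fixes X :: "(int^'n) set set"
  assumes B: "infinite B" "pairwise coprime B" "\<And>b. b \<in> B \<Longrightarrow> b \<ge> 2"
    and X: "X = {U. admissible B U}" and closed: "closedin config_topology X"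
    and "symmetric_subshift X"
  shows "symmetries X = shifts X"
proof
  interpret symmetric_subshift X by fact
  show "shifts X \<subseteq> symmetries X" by (rule shifts_subset_symmetries)
  have code: "\<exists>F. admissible_code B H F" if H: "H \<in> symmetries X" for H
  proof -
    have HA: "H \<in> carrier A" using H by (simp add: mem_symmetries_iff)
    have HX: "H U \<in> X" if "U \<in> X" for U
      using HA that Bij_imp_funcset[of H X] by (auto simp: Aut_def)
    have "continuous_map (subtopology config_topology X) (subtopology config_topology X) H"
      using HA by (simp add: Aut_def homeomorphic_imp_continuous_map)
    from uniform_window[OF closed this] obtain F where F: "finite F"
      "\<And>U U'. U \<in> X \<Longrightarrow> U' \<in> X \<Longrightarrow> U' \<inter> F = U \<inter> F \<Longrightarrow> 0 \<in> H U' \<longleftrightarrow> 0 \<in> H U" by metis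
    have "H (shift n U) = shift n (H U)" if U: "U \<in> X" for n U
    proof -
      have "compose X H (T n) U = compose X (T n) H U"
        using H HA commutes_iff_conj[OF HA] by (simp add: mem_symmetries_iff flip: mult_Aut)
      then show ?thesis using U HX by (simp add: compose_def shift_on_def)
    qed
    moreover have "admissible B U \<longleftrightarrow> U \<in> X" for U by (simp add: X)
    ultimately have "admissible_code B H F"
      by (intro admissible_code.intro B F) (simp_all only: HX)
    then show ?thesis ..
  qed
  show "symmetries X \<subseteq> shifts X"
  proof
    fix H assume H: "H \<in> symmetries X"
    define K where "K = inv\<^bsub>A\<^esub> H"
    have HA: "H \<in> carrier A" and KA: "K \<in> carrier A"
      using H by (auto simp: mem_symmetries_iff K_def)
    have KH: "K (H U) = U" and HK: "H (K U) = U" if "U \<in> X" for U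
    proof -
      have "compose X K H = (\<lambda>U\<in>X. U)" "compose X H K = (\<lambda>U\<in>X. U)"
        using HA KA by (simp_all add: K_def flip: mult_Aut one_Aut)
      then have "compose X K H U = U" "compose X H K U = U" using that by simp_all
      then show "K (H U) = U" "H (K U) = U" using that by (simp_all add: compose_def)
    qed
    have K: "K \<in> symmetries X"
    proof -
      have "T n = K \<otimes>\<^bsub>A\<^esub> (H \<otimes>\<^bsub>A\<^esub> T n \<otimes>\<^bsub>A\<^esub> inv\<^bsub>A\<^esub> H) \<otimes>\<^bsub>A\<^esub> inv\<^bsub>A\<^esub> K" for n
        using HA by (simp add: K_def A.m_assoc cancel)
      then show ?thesis using H KA by (simp add: mem_symmetries_iff)
    qed
    obtain F G where "admissible_code B H F" "admissible_code B K G"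
      using code[OF H] code[OF K] by blast
    then interpret H: admissible_code B H F + K: admissible_code B K G .
    have "H {0} \<noteq> {}"
    proof
      assume "H {0} = {}"
      then have "K (H {0}) = {}" by (simp add: K.H_empty)
      then show False using KH[of "{0}"] by (simp add: X H.admissible_singleton)
    qed
    then obtain p where p: "p \<in> H {0}" by blast
    have "K {0} \<noteq> {}"
    proof
      assume "K {0} = {}"
      then have "H (K {0}) = {}" by (simp add: H.H_empty)
      then show False using HK[of "{0}"] by (simp add: X H.admissible_singleton)
    qed
    then obtain q where q: "q \<in> K {0}" by blast
    have shift0: "shift (- r) {0} = {r}" for r :: "int^'n" by (auto simp: eq_neg_iff_add_eq_0 shift_def)
    have "H {0} \<subseteq> {p}"
      using H.H_finite_subset[OF p, of "{0}"] by (simp add: H.admissible_singleton shift0)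
    then have "H {0} = {p}" using p by blast
    then have "K {p} = {0}" using KH[of "{0}"] by (simp add: X H.admissible_singleton)
    moreover have "q + p \<in> K {p}" using q K.H_singleton[of "q + p" p] by simp
    ultimately have "q + p = 0" by simp
    then have qp: "- q = p" by (rule minus_unique)
    have fin: "H U = shift (- p) U" if U: "finite U" "admissible B U" for U
    proof
      show HU: "H U \<subseteq> shift (- p) U" by (rule H.H_finite_subset[OF p U])
      then have "finite (H U)" by (rule finite_subset) (simp add: shift_def U(1))
      then have "K (H U) \<subseteq> shift (- q) (H U)"
        by (rule K.H_finite_subset[OF q _ H.H_admissible[OF U(2)]])
      then have "U \<subseteq> shift p (H U)" using KH U(2) by (simp add: X qp)
      then have "shift (- p) U \<subseteq> shift (- p) (shift p (H U))" unfolding shift_def by (rule image_mono)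
      then show "shift (- p) U \<subseteq> H U" by (simp add: shift_shift)
    qed
    have "H U = shift (- p) U" if U: "admissible B U" for U
    proof (rule Set.set_eqI)
      fix n
      \<comment> \<open>the finite part of \<open>U\<close> that decides both sides; the extra point \<open>- p\<close> serves the right-hand one\<close>
      define W where "W = U \<inter> (+) n ` insert (- p) F"
      have W: "finite W" "admissible B W"
        using H.F_finite U by (auto simp: W_def intro: admissible_subset)
      have "n \<in> H U \<longleftrightarrow> n \<in> H W"
      proof (rule H.code[OF W(2) U])
        fix f assume "f \<in> F"
        then show "n + f \<in> U \<longleftrightarrow> n + f \<in> W" by (simp add: W_def)
      qed
      also have "\<dots> \<longleftrightarrow> n \<in> shift (- p) U"
        by (simp add: fin[OF W]) (simp add: W_def)
      finally show "n \<in> H U \<longleftrightarrow> n \<in> shift (- p) U" .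
    qed
    moreover have "H \<in> extensional X" using HA by (simp add: Aut_def Bij_def)
    ultimately have "H = T (- p)"
      by (intro extensionalityI[of H X]) (simp_all add: shift_on_def X)
    then show "H \<in> shifts X" by (simp add: shifts_def)
  qed
qed

section \<open>Admissible patterns among the \<open>\<B>\<close>-free points\<close>

lemma summable_on_tail:
  fixes f :: "'a \<Rightarrow> real"
  assumes f: "f summable_on B" and e: "e > 0"
  obtains B0 where "finite B0" "\<And>B'. finite B' \<Longrightarrow> B' \<subseteq> B - B0 \<Longrightarrow> sum f B' < e"
proof -
  have "(sum f \<longlongrightarrow> infsum f B) (finite_subsets_at_top B)"
    using f by (simp add: has_sum_def[symmetric])
  then have "\<forall>\<^sub>F A in finite_subsets_at_top B. dist (sum f A) (infsum f B) < e / 2"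
    using e by (intro tendstoD) simp_all
  then obtain B0 where B0: "finite B0" "B0 \<subseteq> B"
    "\<And>A. finite A \<Longrightarrow> B0 \<subseteq> A \<Longrightarrow> A \<subseteq> B \<Longrightarrow> dist (sum f A) (infsum f B) < e / 2"
    by (auto simp: eventually_finite_subsets_at_top)
  have "sum f B' < e" if B': "finite B'" "B' \<subseteq> B - B0" for B'
  proof -
    have "dist (sum f B0) (infsum f B) < e / 2" using B0 by blast
    moreover have "dist (sum f (B0 \<union> B')) (infsum f B) < e / 2" using B0 B' by (intro B0(3)) auto
    moreover have "sum f (B0 \<union> B') = sum f B0 + sum f B'"
      using B0 B' by (intro sum.union_disjoint) auto
    ultimately show ?thesis unfolding dist_real_def by linarith
  qed
  with B0(1) show ?thesis by (rule that)
qed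

lemma summable_on_tail_nat:
  fixes f :: "nat \<Rightarrow> real"
  assumes f: "f summable_on B" and e: "e > 0"
  obtains K where "\<And>N B'. N \<ge> K \<Longrightarrow> finite B' \<Longrightarrow> B' \<subseteq> {b\<in>B. b > N} \<Longrightarrow> sum f B' < e"
proof -
  obtain B0 where B0: "finite B0" "\<And>B'. finite B' \<Longrightarrow> B' \<subseteq> B - B0 \<Longrightarrow> sum f B' < e"
    using summable_on_tail[OF assms] by blast
  have "b \<le> Max (insert 0 B0)" if "b \<in> B0" for b using B0(1) that by (intro Max_ge) auto
  then have "B' \<subseteq> B - B0" if "N \<ge> Max (insert 0 B0)" "B' \<subseteq> {b\<in>B. b > N}" for N B'
    using that by fastforce
  then show ?thesis using B0(2) that by metis
qed

lemma crt_vec_finite: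
  assumes "finite C" "pairwise coprime C"
  shows "\<exists>x. \<forall>b\<in>C. x - \<rho> b \<in> multiples b"
  using assms
proof induction
  case (insert b C)
  then obtain y where y: "\<forall>a\<in>C. y - \<rho> a \<in> multiples a" by (auto simp: pairwise_insert)
  have "coprime (\<Prod>C) b"
    using insert by (intro prod_coprime_left) (auto simp: pairwise_insert)
  then obtain x where x: "x - y \<in> multiples (\<Prod>C)" "x - \<rho> b \<in> multiples b"
    using crt_vec by blast
  have "x - \<rho> a \<in> multiples a" if "a \<in> C" for a
  proof -
    have "x - y \<in> multiples a"
      by (rule multiples_dvd[OF dvd_prodI[OF insert(1) that] x(1)])
    then have "(x - y) + (y - \<rho> a) \<in> multiples a" using y that by (intro multiples_add) auto
    then show ?thesis by simp
  qed
  with x(2) show ?case by blast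
qed simp

text \<open>
  The solutions \<open>k\<close> lie in one class modulo \<open>b\<close>, so their quotients by \<open>b\<close> are distinct.
\<close>

lemma card_progression_le:
  fixes a :: int
  assumes b: "b > 0" and cop: "coprime Q b"
  shows "card {k\<in>{0..<int N}. int b dvd a + int Q * k} \<le> N div b + 1"
proof -
  let ?A = "{k\<in>{0..<int N}. int b dvd a + int Q * k}"
  let ?f = "\<lambda>k. nat (k div int b)"
  have "inj_on ?f ?A"
  proof (rule inj_onI)
    fix k l assume kl: "k \<in> ?A" "l \<in> ?A" "?f k = ?f l"
    have "int b dvd (a + int Q * k) - (a + int Q * l)" using kl by (intro dvd_diff) auto
    then have "int b dvd int Q * (k - l)" by (simp add: algebra_simps)
    then have "int b dvd k - l"
      using cop by (subst (asm) coprime_dvd_mult_right_iff) (simp_all add: coprime_commute)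
    then have "k mod int b = l mod int b" by (simp add: mod_eq_dvd_iff)
    moreover have "k div int b = l div int b"
      using kl by (simp add: pos_imp_zdiv_nonneg_iff b eq_nat_nat_iff)
    ultimately show "k = l" by (metis mult_div_mod_eq)
  qed
  moreover have "?f ` ?A \<subseteq> {..N div b}"
  proof safe
    fix k assume "k \<in> {0..<int N}"
    then have "k div int b \<le> int N div int b" using b by (intro zdiv_mono1) auto
    then show "nat (k div int b) \<le> N div b" by (simp add: nat_le_iff flip: zdiv_int)
  qed
  ultimately have "card ?A \<le> card {..N div b}" by (rule card_inj_on_le) simp
  then show ?thesis by simp
qed

lemma card_bad_le:
  fixes y :: "int^'n"
  assumes b: "b > 0" and cop: "coprime Q b"
  shows "card {k::int^'n. (\<forall>i. k $ i \<in> {0..<int N}) \<and> y + int Q *s k \<in> multiples b}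
    \<le> (N div b + 1) ^ CARD('n)"
proof -
  have eq: "{k::int^'n. (\<forall>i. k $ i \<in> {0..<int N}) \<and> y + int Q *s k \<in> multiples b}
      = {k. \<forall>i. k $ i \<in> {k\<in>{0..<int N}. int b dvd y $ i + int Q * k}}"
    by (auto simp: mem_multiples)
  have "card {k. \<forall>i. k $ i \<in> {k\<in>{0..<int N}. int b dvd y $ i + int Q * k}}
      = (\<Prod>i\<in>UNIV. card {k\<in>{0..<int N}. int b dvd y $ i + int Q * k})"
    by (rule card_vec_box) (rule finite_subset[of _ "{0..<int N}"], auto)
  also have "\<dots> \<le> (\<Prod>i\<in>(UNIV::'n set). N div b + 1)"
    by (intro prod_mono conjI card_progression_le assms) simp
  finally show ?thesis unfolding eq by simp
qed

text \<open>
  A union bound over the vectors \<open>k\<close> with coordinates in \<open>[0, N)\<close>. A number \<open>b\<close> coprime to \<open>Q\<close>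
  excludes at most \<open>(N div b + 1)\<^sup>d\<close> of them for each \<open>x\<close>, by \<open>card_bad_le\<close>. For \<open>b \<le> N\<close> this is at
  most \<open>(2 N / b)\<^sup>d\<close>, and the sum of these over \<open>b > K\<close> is small by the choice of \<open>K\<close>. After a translation
  into the positive orthant, all coordinates lie between 1 and \<open>D N\<close>, so that no \<open>b > D N\<close> matters. For
  \<open>N < b \<le> D N\<close> at most \<open>1 \<le> (D N / b)\<^sup>d\<close> vectors are excluded. As \<open>D\<close> depends on \<open>Q\<close>, and hence on
  \<open>K\<close>, this last range is controlled by the tail beyond \<open>N\<close>, which is small for large \<open>N\<close>. The bounds on
  the two tails make each range exclude at most \<open>N\<^sup>d / (2 (card S + 1))\<close> vectors for each \<open>x \<in> S\<close>, and
  hence fewer than all \<open>N\<^sup>d\<close> altogether.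
\<close>

lemma exists_good_translate:
  fixes S :: "(int^'n) set"
  assumes S: "finite S" and C: "C \<subseteq> {b\<in>B. b > K}"
    and cop: "\<And>b. b \<in> C \<Longrightarrow> coprime Q b" and Q: "Q > 0"
    and summ: "(\<lambda>b. 1 / real b ^ CARD('n)) summable_on B"
    and tail: "\<And>B'. finite B' \<Longrightarrow> B' \<subseteq> {b\<in>B. b > K} \<Longrightarrow>
      (\<Sum>b\<in>B'. 1 / real b ^ CARD('n)) < 1 / (2 * (real (card S) + 1) * 2 ^ CARD('n))"
  shows "\<exists>k. \<forall>x\<in>S. \<forall>b\<in>C. x + int Q *s k \<notin> multiples b"
proof -
  let ?d = "CARD('n)"
  let ?f = "\<lambda>b. 1 / real b ^ ?d"
  let ?m = "real (card S) + 1"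
  \<comment> \<open>adding \<open>Q e\<close> moves \<open>S\<close> into the positive orthant\<close>
  define M where "M = Max (insert 1 ((\<lambda>(x, i). \<bar>x $ i\<bar>) ` (S \<times> UNIV)))"
  have M: "\<bar>x $ i\<bar> \<le> M" if "x \<in> S" for x i
    unfolding M_def by (rule Max_ge) (use S that in \<open>auto intro!: image_eqI[of _ _ "(x, i)"]\<close>)
  have M1: "M \<ge> 1" unfolding M_def by (rule Max_ge) (use S in auto)
  define e :: "int^'n" where "e = vec (M + 1)"
  define D where "D = nat (M + int Q * (M + 1)) + Q"
  have D: "int D = M + int Q * (M + 1) + int Q" using M1 by (simp add: D_def)
  have "D > 0" using Q by (simp add: D_def)
  obtain N0 where N0: "\<And>N B'. N \<ge> N0 \<Longrightarrow> finite B' \<Longrightarrow> B' \<subseteq> {b\<in>B. b > N} \<Longrightarrow>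
      sum ?f B' < 1 / (2 * ?m * real D ^ ?d)"
    using summable_on_tail_nat[OF summ, of "1 / (2 * ?m * real D ^ ?d)"] \<open>D > 0\<close> by auto
  define N where "N = max 1 N0"
  have N: "N \<ge> 1" "N \<ge> N0" by (auto simp: N_def)
  define box where "box = {k::int^'n. \<forall>i. k $ i \<in> {0..<int N}}"
  have box: "finite box" "card box = N ^ ?d"
    unfolding box_def by (rule finite_vec_box, simp) (subst card_vec_box, simp_all)
  define C1 where "C1 = {b\<in>C. b \<le> D * N}"
  have C1: "finite C1" unfolding C1_def by (rule finite_subset[of _ "{..D * N}"]) auto
  have C1B: "b \<in> B" "b > K" "coprime Q b" "b > 0" if "b \<in> C1" for b
    using that C cop by (force simp: C1_def)+
  define bad where "bad x b = {k\<in>box. x + int Q *s e + int Q *s k \<in> multiples b}" for x b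
  have bad_card: "real (card (bad x b)) \<le> (real (N div b) + 1) ^ ?d" if "b \<in> C1" for x b
  proof -
    have "card (bad x b) \<le> (N div b + 1) ^ ?d"
      unfolding bad_def box_def using card_bad_le[OF C1B(4,3)[OF that], of N "x + int Q *s e"] by simp
    then have "real (card (bad x b)) \<le> real ((N div b + 1) ^ ?d)" by (simp only: of_nat_le_iff)
    then show ?thesis by (simp add: add.commute)
  qed
  have small: "real (card (bad x b)) \<le> (2 * real N) ^ ?d * ?f b" if b: "b \<in> C1" "b \<le> N" for x b
  proof -
    have "real (N div b) + 1 \<le> real N / real b + real N / real b"
      using b C1B(4)[OF b(1)] by (intro add_mono) (simp_all add: of_nat_div_le_of_nat)
    also have "\<dots> = 2 * real N / real b" by simp
    finally have "(real (N div b) + 1) ^ ?d \<le> (2 * real N / real b) ^ ?d" by (intro power_mono) simp_all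
    then show ?thesis using bad_card[OF b(1), of x] by (simp add: power_divide)
  qed
  have large: "real (card (bad x b)) \<le> (real D * real N) ^ ?d * ?f b" if b: "b \<in> C1" "b > N" for x b
  proof -
    have "real b \<le> real (D * N)" using b(1) unfolding C1_def by (simp only: mem_Collect_eq of_nat_le_iff)
    then have "real (N div b) + 1 \<le> real D * real N / real b"
      using b C1B(4)[OF b(1)] by simp
    then have "(real (N div b) + 1) ^ ?d \<le> (real D * real N / real b) ^ ?d" by (intro power_mono) simp_all
    then show ?thesis using bad_card[OF b(1), of x] by (simp add: power_divide)
  qed
  have one: "(\<Sum>b\<in>C1. real (card (bad x b))) \<le> real N ^ ?d / ?m" for x
  proof -
    let ?A = "{b\<in>C1. b \<le> N}" and ?E = "{b\<in>C1. b > N}"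
    have "C1 = ?A \<union> ?E" by auto
    then have "(\<Sum>b\<in>C1. real (card (bad x b))) = (\<Sum>b\<in>?A. real (card (bad x b))) + (\<Sum>b\<in>?E. real (card (bad x b)))"
      using C1 by (metis (no_types, lifting) sum.union_disjoint finite_Un disjoint_iff linorder_not_le mem_Collect_eq)
    also have "\<dots> \<le> (\<Sum>b\<in>?A. (2 * real N) ^ ?d * ?f b) + (\<Sum>b\<in>?E. (real D * real N) ^ ?d * ?f b)"
      by (intro add_mono sum_mono) (use small large in auto)
    also have "\<dots> = (2 * real N) ^ ?d * sum ?f ?A + (real D * real N) ^ ?d * sum ?f ?E"
      by (simp only: sum_distrib_left)
    also have "\<dots> \<le> (2 * real N) ^ ?d * (1 / (2 * ?m * 2 ^ ?d)) + (real D * real N) ^ ?d * (1 / (2 * ?m * real D ^ ?d))"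
    proof (intro add_mono mult_left_mono)
      show "sum ?f ?A \<le> 1 / (2 * ?m * 2 ^ ?d)"
        using tail[of ?A] C1 C1B by (intro less_imp_le) auto
      show "sum ?f ?E \<le> 1 / (2 * ?m * real D ^ ?d)"
        using N0[OF N(2), of ?E] C1 C1B by (intro less_imp_le) auto
    qed simp_all
    also have "\<dots> = real N ^ ?d / ?m"
    proof -
      have half: "(c * real N) ^ ?d * (1 / (2 * m * c ^ ?d)) = real N ^ ?d / m / 2" if "c > 0" for c m :: real
        using that by (simp add: power_mult_distrib)
      have "0 < real D" using \<open>D > 0\<close> by simp
      then show ?thesis by (simp only: half[OF zero_less_numeral] half field_sum_of_halves)
    qed
    finally show ?thesis .
  qed
  have "real (card (\<Union>x\<in>S. \<Union>b\<in>C1. bad x b)) \<le> (\<Sum>x\<in>S. \<Sum>b\<in>C1. real (card (bad x b)))"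
  proof -
    have "card (\<Union>x\<in>S. \<Union>b\<in>C1. bad x b) \<le> (\<Sum>x\<in>S. card (\<Union>b\<in>C1. bad x b))"
      by (rule card_UN_le[OF S])
    also have "\<dots> \<le> (\<Sum>x\<in>S. \<Sum>b\<in>C1. card (bad x b))"
      by (intro sum_mono card_UN_le C1)
    finally have "real (card (\<Union>x\<in>S. \<Union>b\<in>C1. bad x b)) \<le> real (\<Sum>x\<in>S. \<Sum>b\<in>C1. card (bad x b))"
      by (simp only: of_nat_le_iff)
    then show ?thesis by simp
  qed
  also have "\<dots> \<le> (\<Sum>x\<in>S. real N ^ ?d / ?m)" by (intro sum_mono one)
  also have "\<dots> < real N ^ ?d" using N by (simp add: field_simps)
  finally have "card (\<Union>x\<in>S. \<Union>b\<in>C1. bad x b) < card box" by (simp add: box flip: of_nat_power)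
  moreover have "finite (\<Union>x\<in>S. \<Union>b\<in>C1. bad x b)" using S C1 box by (auto simp: bad_def)
  ultimately obtain k where k: "k \<in> box" "k \<notin> (\<Union>x\<in>S. \<Union>b\<in>C1. bad x b)"
    by (metis card_mono linorder_not_le subsetI)
  have "x + int Q *s (e + k) \<notin> multiples b" if x: "x \<in> S" and b: "b \<in> C" for x b
  proof
    assume mult: "x + int Q *s (e + k) \<in> multiples b"
    have eq: "x + int Q *s (e + k) = x + int Q *s e + int Q *s k" by (simp add: vec_eq_iff algebra_simps)
    let ?v = "x $ undefined + int Q * (M + 1 + k $ undefined)"
    have ki: "0 \<le> k $ undefined" "k $ undefined < int N" using k(1) by (auto simp: box_def)
    have "int b dvd (x + int Q *s (e + k)) $ undefined" using mult unfolding mem_multiples by blast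
    then have "int b dvd ?v" by (simp add: e_def distrib_left)
    moreover have "?v > 0"
    proof -
      have "M + 1 + k $ undefined \<le> int Q * (M + 1 + k $ undefined)" using Q M1 ki by simp
      then show ?thesis using M[OF x, of undefined] ki M1 by linarith
    qed
    ultimately have "int b \<le> ?v" by (rule zdvd_imp_le)
    also have "?v \<le> M + int Q * (M + 1) + int Q * int N"
    proof -
      have "int Q * k $ undefined \<le> int Q * int N" using ki by (intro mult_left_mono) auto
      then show ?thesis using M[OF x, of undefined] by (simp add: algebra_simps)
    qed
    also have "\<dots> \<le> (M + int Q * (M + 1)) * int N + int Q * int N"
    proof -
      have "0 \<le> M + int Q * (M + 1)" using M1 by simp
      then have "(M + int Q * (M + 1)) * 1 \<le> (M + int Q * (M + 1)) * int N"
        using N by (intro mult_left_mono) auto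
      then show ?thesis by simp
    qed
    also have "\<dots> = int (D * N)" by (simp add: D algebra_simps)
    finally have "b \<le> D * N" by (simp only: of_nat_le_iff)
    then have "b \<in> C1" using b by (simp add: C1_def)
    then have "k \<in> bad x b" using mult[unfolded eq] k(1) unfolding bad_def by blast
    then show False using k(2) x \<open>b \<in> C1\<close> by blast
  qed
  then show ?thesis by blast
qed

text \<open>
  Each point \<open>x\<close> of \<open>F\<close> outside \<open>U\<close> gets its own large modulus \<open>\<beta> x\<close> and is translated into
  \<open>(\<beta> x)\<int>\<^sup>d\<close>; a large modulus separates the points of \<open>F\<close>, so the others are not affected. For the
  moduli up to \<open>K\<close>, a class that \<open>U\<close> misses is translated to the class of zero. The translations
  left over form a class modulo \<open>Q\<close>, from which \<open>exists_good_translate\<close> selects one.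
\<close>

lemma admissible_pattern_occurs:
  fixes U F :: "(int^'n) set"
  assumes B: "infinite B" "erdos CARD('n) B" "\<forall>b\<in>B. b > 0"
    and U: "admissible B U" and F: "finite F"
  shows "\<exists>t. \<forall>x\<in>F. x \<in> U \<longleftrightarrow> x + t \<in> bfree_points B"
proof -
  let ?d = "CARD('n)"
  have cop: "pairwise coprime B" and summ: "(\<lambda>b. 1 / real b ^ ?d) summable_on B"
    using B(2) by (auto simp: erdos_def)
  define S where "S = U \<inter> F"
  define G where "G = F - U"
  have fin: "finite S" "finite G" using F by (auto simp: S_def G_def)
  obtain K0 where K0: "\<And>N B'. N \<ge> K0 \<Longrightarrow> finite B' \<Longrightarrow> B' \<subseteq> {b\<in>B. b > N} \<Longrightarrow>
      (\<Sum>b\<in>B'. 1 / real b ^ ?d) < 1 / (2 * (real (card S) + 1) * 2 ^ ?d)"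
    using summable_on_tail_nat[OF summ, of "1 / (2 * (real (card S) + 1) * 2 ^ ?d)"] by auto
  obtain K1 where K1: "\<And>x y b. x \<in> F \<Longrightarrow> y \<in> F \<Longrightarrow> x \<noteq> y \<Longrightarrow> b > K1 \<Longrightarrow> x - y \<notin> multiples b"
  proof -
    let ?D = "(\<lambda>(x, y). x - y) ` (F \<times> F) - {0}"
    obtain N where "\<And>z b. z \<in> ?D \<Longrightarrow> b > N \<Longrightarrow> z \<notin> multiples b"
      using multiples_large[of ?D] F by blast
    then show ?thesis using that by fastforce
  qed
  \<comment> \<open>beyond \<open>K0\<close> the tail of the series is small, beyond \<open>K1\<close> a modulus separates the points of \<open>F\<close>\<close>
  define K where "K = max K0 K1"
  have "infinite {b\<in>B. b > K}"
  proof
    assume "finite {b\<in>B. b > K}"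
    then have "finite ({b\<in>B. b > K} \<union> {..K})" by simp
    then have "finite B" by (rule rev_finite_subset) auto
    then show False using B(1) by contradiction
  qed
  then obtain B2 where B2: "B2 \<subseteq> {b\<in>B. b > K}" "finite B2" "card B2 = card G"
    by (metis infinite_arbitrarily_large)
  then obtain \<beta> where \<beta>: "bij_betw \<beta> G B2" using finite_same_card_bij[OF fin(2)] by metis
  define \<gamma> where "\<gamma> = inv_into G \<beta>"
  have \<gamma>: "\<gamma> b \<in> G" "\<beta> (\<gamma> b) = b" if "b \<in> B2" for b
    using \<beta> that by (auto simp: \<gamma>_def bij_betw_def inv_into_into f_inv_into_f)
  have \<gamma>\<beta>: "\<gamma> (\<beta> x) = x" "\<beta> x \<in> B2" if "x \<in> G" for x
    using \<beta> that by (auto simp: \<gamma>_def bij_betw_def)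
  obtain c where c: "\<And>b x. b \<in> B \<Longrightarrow> x \<in> U \<Longrightarrow> x - c b \<notin> multiples b"
    using U unfolding admissible_iff by metis
  define B1 where "B1 = {b\<in>B. b \<le> K} \<union> B2"
  have B1: "finite B1" "B1 \<subseteq> B" using B2 by (auto simp: B1_def intro: finite_subset[of _ "{..K}"])
  obtain s where s: "\<And>b. b \<in> B1 \<Longrightarrow> s - (if b \<le> K then - c b else - \<gamma> b) \<in> multiples b"
    using crt_vec_finite[OF B1(1) pairwise_subset[OF cop B1(2)], of "\<lambda>b. if b \<le> K then - c b else - \<gamma> b"] by blast
  define Q where "Q = \<Prod>B1"
  have "Q > 0" unfolding Q_def using B1 B(3) by (intro prod_pos) auto
  define C where "C = B - B1"
  have "coprime Q b" if "b \<in> C" for b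
    unfolding Q_def
    by (rule prod_coprime_left) (use that cop B1 in \<open>auto simp: C_def pairwise_def\<close>)
  moreover have "C \<subseteq> {b\<in>B. b > K}" by (auto simp: C_def B1_def)
  moreover have "card ((\<lambda>x. x + s) ` S) = card S" by (simp add: card_image)
  ultimately have "\<exists>k. \<forall>x\<in>(\<lambda>x. x + s) ` S. \<forall>b\<in>C. x + int Q *s k \<notin> multiples b"
    using \<open>Q > 0\<close> summ K0[of K] fin(1)
    by (intro exists_good_translate[of _ C B K Q]) (simp_all add: K_def)
  then obtain k where k: "\<And>x b. x \<in> S \<Longrightarrow> b \<in> C \<Longrightarrow> x + s + int Q *s k \<notin> multiples b" by auto
  define t where "t = s + int Q *s k"
  have t: "x + t \<in> multiples b \<longleftrightarrow> x + (if b \<le> K then - c b else - \<gamma> b) \<in> multiples b"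
    if "b \<in> B1" for x b
  proof -
    have "int Q *s k \<in> multiples b"
      by (rule multiples_smult) (use B1 that in \<open>simp add: Q_def dvd_prodI\<close>)
    let ?r = "if b \<le> K then - c b else - \<gamma> b"
    have "(s - ?r) + int Q *s k \<in> multiples b"
      by (rule multiples_add[OF s[OF that] \<open>int Q *s k \<in> multiples b\<close>])
    moreover have "(s - ?r) + int Q *s k = t - ?r" by (simp add: t_def)
    ultimately have td: "t - ?r \<in> multiples b" by (simp only:)
    have eq: "x + t = (x + ?r) + (t - ?r)" "x + ?r = (x + t) - (t - ?r)" by simp_all
    show ?thesis
    proof
      assume "x + t \<in> multiples b"
      then show "x + ?r \<in> multiples b" by (subst eq(2)) (rule multiples_diff[OF _ td])
    next
      assume "x + ?r \<in> multiples b"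
      then show "x + t \<in> multiples b" by (subst eq(1)) (rule multiples_add[OF _ td])
    qed
  qed
  have B2K: "\<not> b \<le> K" "b \<in> B1" "b \<in> B" if "b \<in> B2" for b using that B2 by (auto simp: B1_def)
  have "x \<in> U \<longleftrightarrow> x + t \<in> bfree_points B" if x: "x \<in> F" for x
  proof
    assume "x \<in> U"
    then have xS: "x \<in> S" using x by (simp add: S_def)
    have "x + t \<notin> multiples b" if b: "b \<in> B" for b
    proof -
      consider "b \<in> C" | "b \<in> B1" "b \<le> K" | "b \<in> B2" "\<not> b \<le> K"
        using b B2K by (auto simp: C_def B1_def)
      then show ?thesis
      proof cases
        case 1
        then show ?thesis using k[OF xS] by (simp add: t_def add.assoc)
      next
        case 2
        then show ?thesis using t[of b x] c[OF b \<open>x \<in> U\<close>] by simp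
      next
        case 3
        then have "\<gamma> b \<in> F" "\<gamma> b \<noteq> x" using \<gamma>(1)[of b] \<open>x \<in> U\<close> by (auto simp: G_def)
        then have "x - \<gamma> b \<notin> multiples b" using x 3 by (intro K1) (auto simp: K_def)
        then show ?thesis using t[of b x] B2K(2)[OF 3(1)] 3(2) by simp
      qed
    qed
    then show "x + t \<in> bfree_points B" by (simp add: mem_bfree_points)
  next
    assume xt: "x + t \<in> bfree_points B"
    show "x \<in> U"
    proof (rule ccontr)
      assume "x \<notin> U"
      then have xG: "x \<in> G" using x by (simp add: G_def)
      have b: "\<beta> x \<in> B1" "\<not> \<beta> x \<le> K" "\<beta> x \<in> B" using B2K[OF \<gamma>\<beta>(2)[OF xG]] by auto
      have "x + t \<in> multiples (\<beta> x)" using t[OF b(1), of x] b(2) \<gamma>\<beta>(1)[OF xG] by simp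
      then show False using xt b(3) by (simp add: mem_bfree_points)
    qed
  qed
  then show ?thesis by blast
qed

section \<open>Extended symmetries of \<open>\<B>\<close>-free lattice systems\<close>

lemma closedin_bfree_system: "closedin config_topology (bfree_system B)"
  by (simp add: bfree_system_def)

lemma bfree_system_erdos:
  assumes "infinite B" "\<forall>b\<in>B. b > 0" "erdos CARD('n) B"
  shows "(bfree_system B :: (int^'n) set set) = {U. admissible B U}"
proof
  show "(bfree_system B :: (int^'n) set set) \<subseteq> {U. admissible B U}"
    using bfree_system_imp_admissible[OF assms(2)] by blast
  show "{U. admissible B U} \<subseteq> (bfree_system B :: (int^'n) set set)"
    using admissible_pattern_occurs[OF assms(1,3,2)] by (auto simp: mem_bfree_system)
qed

theorem theorem4p5:
  fixes B :: "nat set" and X :: "(int^'n) set set"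
  assumes "infinite B" and "\<forall>b\<in>B. b > 0" and "primitive B"
    and "X = bfree_system B"
  shows
    "internal_semidirect (ext_symmetries X) (symmetries X) (matrix_on X ` carrier GLZ)
     \<and> matrix_on X \<in> mon GLZ (ext_symmetries X)
     \<and> (\<forall>H \<in> carrier (ext_symmetries X). \<forall>n.
          H \<otimes>\<^bsub>Aut X\<^esub> shift_on X n \<otimes>\<^bsub>Aut X\<^esub> inv\<^bsub>Aut X\<^esub> H = shift_on X (psi X H *v n))
     \<and> psi X \<in> epi (ext_symmetries X) GLZ
     \<and> kernel (ext_symmetries X) GLZ (psi X) = symmetries X
     \<and> (\<forall>M \<in> carrier GLZ. psi X (matrix_on X M) = M)
     \<and> (erdos CARD('n) B \<longrightarrow>
          X = {U. admissible B U}
          \<and> hereditary X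
          \<and> symmetries X = shifts X
          \<and> shift_on X \<in> iso lattice_group ((Aut X)\<lparr>carrier := symmetries X\<rparr>)
          \<and> internal_semidirect (ext_symmetries X) (shifts X) (matrix_on X ` carrier GLZ)
          \<and> (\<lambda>(n, M). shift_on X n \<otimes>\<^bsub>Aut X\<^esub> matrix_on X M)
              \<in> iso lattice_semidirect_GLZ (ext_symmetries X))"
proof -
  have sub: "symmetric_subshift X"
    unfolding assms(4) by (rule symmetric_subshift_bfree_system[OF assms(1,3)])
  interpret symmetric_subshift X by (rule sub)
  have closed: "closedin config_topology X" by (simp add: assms(4) closedin_bfree_system)
  have erdos: "X = {U. admissible B U} \<and> hereditary X \<and> symmetries X = shifts X"
    if E: "erdos CARD('n) B"
  proof -
    have X: "X = {U. admissible B U}"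
      unfolding assms(4) by (rule bfree_system_erdos[OF assms(1,2) E])
    have "shift t ` X = X" for t
    proof
      show "shift t ` X \<subseteq> X" using shift_closed by blast
      show "X \<subseteq> shift t ` X"
      proof
        fix U assume "U \<in> X"
        then show "U \<in> shift t ` X"
          by (intro image_eqI[of _ _ "shift (- t) U"]) (simp_all add: shift_shift shift_closed)
      qed
    qed
    then have "subshift X" using closed by (simp add: subshift_def)
    moreover have "W \<in> X" if "U \<in> X" "W \<subseteq> U" for U W
      using admissible_subset[OF _ that(2)] that(1) unfolding X by simp
    ultimately have "hereditary X" by (simp add: hereditary_def)
    moreover have "b \<ge> 2" if "b \<in> B" for b
    proof -
      have "b \<noteq> 1"
      proof
        assume "b = 1"
        have "a = 1" if "a \<in> B" for a
          using assms(3)[unfolded primitive_def, rule_format, OF \<open>b \<in> B\<close> that] \<open>b = 1\<close> by simp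
        then have "B \<subseteq> {1}" by blast
        then show False using assms(1) finite_subset by blast
      qed
      moreover have "b > 0" using assms(2) that by blast
      ultimately show ?thesis by simp
    qed
    then have "symmetries X = shifts X"
      using E by (intro symmetries_admissible[OF assms(1) _ _ X closed sub]) (simp_all add: erdos_def)
    ultimately show ?thesis using X by (intro conjI)
  qed
  have symm: "\<forall>H\<in>carrier (ext_symmetries X). \<forall>n.
      H \<otimes>\<^bsub>Aut X\<^esub> shift_on X n \<otimes>\<^bsub>Aut X\<^esub> inv\<^bsub>Aut X\<^esub> H = shift_on X (psi X H *v n)"
    using psi_conj by blast
  have split: "\<forall>M\<in>carrier GLZ. psi X (matrix_on X M) = M" by (simp add: GLZ_def psi_matrix_on)
  have "erdos CARD('n) B \<longrightarrow> X = {U. admissible B U} \<and> hereditary X \<and> symmetries X = shifts X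
      \<and> shift_on X \<in> iso lattice_group ((Aut X)\<lparr>carrier := symmetries X\<rparr>)
      \<and> internal_semidirect (ext_symmetries X) (shifts X) (matrix_on X ` carrier GLZ)
      \<and> (\<lambda>(n, M). shift_on X n \<otimes>\<^bsub>Aut X\<^esub> matrix_on X M) \<in> iso lattice_semidirect_GLZ (ext_symmetries X)"
  proof
    assume E: "erdos CARD('n) B"
    note E' = erdos[OF E]
    have sym: "symmetries X = shifts X" by (rule E'[THEN conjunct2, THEN conjunct2])
    show "X = {U. admissible B U} \<and> hereditary X \<and> symmetries X = shifts X
      \<and> shift_on X \<in> iso lattice_group ((Aut X)\<lparr>carrier := symmetries X\<rparr>)
      \<and> internal_semidirect (ext_symmetries X) (shifts X) (matrix_on X ` carrier GLZ)
      \<and> (\<lambda>(n, M). shift_on X n \<otimes>\<^bsub>Aut X\<^esub> matrix_on X M) \<in> iso lattice_semidirect_GLZ (ext_symmetries X)"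
      by (intro conjI E'[THEN conjunct1] E'[THEN conjunct2, THEN conjunct1] sym
          shift_on_iso[OF sym] semidirect[unfolded sym] semidirect_iso[OF sym])
  qed
  with semidirect matrix_on_mon symm psi_epi kernel_psi split show ?thesis
    by (intro conjI)
qed

end
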